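(* Let $\mathcal{R}$ be the category of constellations with range with range radiants as morphisms, and let $\mathcal{IS}$ be the category of IS-categories with IS-functors as morphisms. (a) The mapping $\phi$ taking any constellation with range $Q$ to its canonical extension $C(Q)$ (an IS-category, which is regular if $Q$ is left cancellative) and any range radiant $\rho:P\to Q$ to the IS-functor $F_\rho:C(P)\to C(Q)$, $(s,e)\mapsto(s\rho,e\rho)$, is a functor $\mathcal{R}\to\mathcal{IS}$. (b) The mapping $\psi$ taking any IS-category $C$ to the constellation with range $S'_C$ (which is left cancellative if $C$ is regular) and any IS-functor $F:C\to D$ to its restriction $\rho_F:S'_C\to S'_D$ is a functor $\mathcal{IS}\to\mathcal{R}$. (c) There are natural isomorphisms $\eta:I_{\mathcal{R}}\to\phi\psi$ and $\tau:I_{\mathcal{IS}}\to\psi\phi$ (where $I_{\mathcal R},I_{\mathcal{IS}}$ are the identity functors and composites are read left to right) such that for every $P\in\mathcal{R}$, $\eta_P:P\to C_S(P)$ (the latter viewed as a constellation with range) is given by $s\eta_P=(s,R(s))$ for all $s\in P$, and for every $C\in\mathcal{IS}$, $\tau_C:C\to C(S'_C)$ is given, for all $x\in C$, by $x\tau_C=(s,R(x))$ where $x=s\circ i$ with $s\in S_C$, $i\in I_C$. Hence $\mathcal{R}$ and $\mathcal{IS}$ are equivalent categories, with associated functors $\phi$ and $\psi$.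
   Context: Categories (object-free). A category is a class $C$ with a partial binary operation $\circ$ such that: (C1) $x\circ(y\circ z)$ exists iff $(x\circ y)\circ z$ exists, and then they are equal; (C2) if $x\circ y$ and $y\circ z$ exist then so does $x\circ(y\circ z)$; (C3) for each $x$ there are identities $e,f$ with $e\circ x$ and $x\circ f$ existing (an identity is an $e$ with $x\circ e=x$ whenever $x\circ e$ exists and $e\circ x=x$ whenever $e\circ x$ exists). These $e,f$ are unique and written $D(x)=e$, $R(x)=f$; $x\circ y$ exists iff $R(x)=D(y)$. $D(C)=\{D(x)\mid x\in C\}$. Compositions are read left to right, so $s$ is an epimorphism if $s\circ x=s\circ y$ implies $x=y$. Functions are written on the right. Constellations. A constellation is a class $Q$ with a partial binary operation $\cdot$ such that: (Q1) if $x\cdot(y\cdot z)$ exists then $(x\cdot y)\cdot z$ exists and they are equal; (Q2) if $x\cdot y$ and $y\cdot z$ exist then so does $x\cdot(y\cdot z)$; (Q3) for each $x\in Q$ there is a unique right identity $e$ with $e\cdot x=x$ (a right identity is an $e$ with $x\cdot e=x$ whenever $x\cdot e$ exists); put $D(x)=e$, $D(Q)=\{D(x)\mid x\in Q\}$. For $e,f\in D(Q)$, $e\leq f$ iff $e\cdot f$ exists. A constellation with range is a constellation in which for each $s$ the set $\{e\in D(Q)\mid s\cdot e\text{ exists, and for all }f\in D(Q),\ s\cdot f\text{ exists implies }e\leq f\}$ has exactly one element, $R(s)$, and $R(R(s)\cdot t)=R(s\cdot t)$ whenever $s\cdot t$ exists; it is left cancellative if $a\cdot b=a\cdot c$ implies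 $R(a)\cdot b=R(a)\cdot c$. A range radiant $\rho:Q_1\to Q_2$ between constellations with range is a function with $D(s\rho)=D(s)\rho$, $R(s\rho)=R(s)\rho$, and such that if $s\cdot t$ exists then $(s\rho)\cdot(t\rho)$ exists and equals $(s\cdot t)\rho$. IS-categories. An IS-category is a category $C$ with specified subcategories $I_C$ and $S_C$, each containing $D(C)$, such that (IS1) for $e,f\in D(C)$ there is at most one $i\in I_C$ such that either ($D(i)=e$ and $R(i)=f$) or ($D(i)=f$ and $R(i)=e$); (IS2) for all $a\in C$ there are unique $s_a\in S_C$ and $i_a\in I_C$ with $a=s_a\circ i_a$. It is regular if $S_C$ consists of epimorphisms of $C$. An IS-functor $F:C_1\to C_2$ is a functor with $I_{C_1}F\subseteq I_{C_2}$ and $S_{C_1}F\subseteq S_{C_2}$. Canonical extension. For a constellation with range $Q$, $C(Q)=\{(s,e)\mid s\in Q,\ e\in D(Q),\ s\cdot e\text{ exists}\}$ is the category with $D((s,e))=(D(s),D(s))$, $R((s,e))=(e,e)$, $(s,e)\circ(t,f)=(s\cdot t,f)$ when $e=D(t)$; it is an IS-category with $I_{C(Q)}=C_I(Q)=\{(e,f)\mid e,f\in D(Q),\ e\cdot f\text{ exists}\}$ and $S_{C(Q)}=C_S(Q)=\{(s,R(s))\mid s\in Q\}$. The constellation $S'_C$. On an IS-category $C$ the I-order is: $s\leq_I t$ iff there are $i,j\in I_C$ such that $s\circ i$ and $j\circ t$ exist and are equal; it is a partial order. For $s\in S_C$ and $e\in D(C)$ with $e\leq_I D(s)$ there is a unique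 $x\in S_C$ with $x\leq_I s$ and $D(x)=e$, denoted $e|s$. $S'_C$ is the class $S_C$ with the same $D,R$ and the product $s\cdot t=s\circ(R(s)|t)$ defined exactly when $R(s)\leq_I D(t)$; it is a constellation with range. "$C_S(P)$ viewed as a constellation with range" means $S'_{C(P)}$. *)

theory Defs
  imports Main "HOL-Library.FuncSet"
begin

section \<open>Classes with a partial binary operation\<close>

text \<open>
  A class is a subset of a type; \<open>mult Q x y = None\<close> means that the product of \<open>x\<close> and \<open>y\<close> does not
  exist. An equation \<open>mult Q x y = Some z\<close> says that the product exists and equals \<open>z\<close>.
\<close>

record 'a pstruct =
  carrier :: "'a set"
  mult :: "'a \<Rightarrow> 'a \<Rightarrow> 'a option"

definition partial_op :: "('a, 'b) pstruct_scheme \<Rightarrow> bool" where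
  "partial_op Q \<longleftrightarrow>
     (\<forall>x y z. mult Q x y = Some z \<longrightarrow> x \<in> carrier Q \<and> y \<in> carrier Q \<and> z \<in> carrier Q)"

definition mult_r :: "('a, 'b) pstruct_scheme \<Rightarrow> 'a \<Rightarrow> 'a \<Rightarrow> 'a \<Rightarrow> 'a option" where
  "mult_r Q x y z = Option.bind (mult Q y z) (\<lambda>w. mult Q x w)"

definition mult_l :: "('a, 'b) pstruct_scheme \<Rightarrow> 'a \<Rightarrow> 'a \<Rightarrow> 'a \<Rightarrow> 'a option" where
  "mult_l Q x y z = Option.bind (mult Q x y) (\<lambda>w. mult Q w z)"


section \<open>Object-free categories\<close>

definition cat_identity :: "('a, 'b) pstruct_scheme \<Rightarrow> 'a \<Rightarrow> bool" where
  "cat_identity C e \<longleftrightarrow> e \<in> carrier C \<and>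
     (\<forall>x\<in>carrier C. mult C x e \<noteq> None \<longrightarrow> mult C x e = Some x) \<and>
     (\<forall>x\<in>carrier C. mult C e x \<noteq> None \<longrightarrow> mult C e x = Some x)"

definition of_category :: "('a, 'b) pstruct_scheme \<Rightarrow> bool" where
  "of_category C \<longleftrightarrow> partial_op C \<and>
     (\<forall>x\<in>carrier C. \<forall>y\<in>carrier C. \<forall>z\<in>carrier C.
        (mult_r C x y z \<noteq> None \<longleftrightarrow> mult_l C x y z \<noteq> None) \<and>
        (mult_r C x y z \<noteq> None \<longrightarrow> mult_r C x y z = mult_l C x y z)) \<and>
     (\<forall>x\<in>carrier C. \<forall>y\<in>carrier C. \<forall>z\<in>carrier C.
        mult C x y \<noteq> None \<and> mult C y z \<noteq> None \<longrightarrow> mult_r C x y z \<noteq> None) \<and>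
     (\<forall>x\<in>carrier C. \<exists>e f. cat_identity C e \<and> cat_identity C f \<and>
        mult C e x \<noteq> None \<and> mult C x f \<noteq> None)"

definition cat_dom :: "('a, 'b) pstruct_scheme \<Rightarrow> 'a \<Rightarrow> 'a" where
  "cat_dom C x = (THE e. cat_identity C e \<and> mult C e x \<noteq> None)"

definition cat_ran :: "('a, 'b) pstruct_scheme \<Rightarrow> 'a \<Rightarrow> 'a" where
  "cat_ran C x = (THE f. cat_identity C f \<and> mult C x f \<noteq> None)"

definition cat_doms :: "('a, 'b) pstruct_scheme \<Rightarrow> 'a set" where
  "cat_doms C = cat_dom C ` carrier C"

definition subcategory :: "('a, 'b) pstruct_scheme \<Rightarrow> 'a set \<Rightarrow> bool" where
  "subcategory C A \<longleftrightarrow> A \<subseteq> carrier C \<and>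
     (\<forall>x\<in>A. cat_dom C x \<in> A \<and> cat_ran C x \<in> A) \<and>
     (\<forall>x\<in>A. \<forall>y\<in>A. \<forall>z. mult C x y = Some z \<longrightarrow> z \<in> A)"

text \<open>Composition is read left to right, so an epimorphism is cancellable on the left.\<close>

definition epimorphism :: "('a, 'b) pstruct_scheme \<Rightarrow> 'a \<Rightarrow> bool" where
  "epimorphism C s \<longleftrightarrow> s \<in> carrier C \<and>
     (\<forall>x\<in>carrier C. \<forall>y\<in>carrier C. mult C s x \<noteq> None \<and> mult C s x = mult C s y \<longrightarrow> x = y)"

text \<open>
  Structure-preserving maps are extensional functions (undefined outside the domain), so that two maps
  that agree on the domain are equal.
\<close>

definition of_functor ::
    "('a, 'c) pstruct_scheme \<Rightarrow> ('b, 'd) pstruct_scheme \<Rightarrow> ('a \<Rightarrow> 'b) \<Rightarrow> bool" where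
  "of_functor C1 C2 F \<longleftrightarrow> F \<in> carrier C1 \<rightarrow>\<^sub>E carrier C2 \<and>
     (\<forall>x\<in>carrier C1. cat_dom C2 (F x) = F (cat_dom C1 x) \<and> cat_ran C2 (F x) = F (cat_ran C1 x)) \<and>
     (\<forall>x\<in>carrier C1. \<forall>y\<in>carrier C1. \<forall>z.
        mult C1 x y = Some z \<longrightarrow> mult C2 (F x) (F y) = Some (F z))"


section \<open>Constellations with range\<close>

definition right_identity :: "('a, 'b) pstruct_scheme \<Rightarrow> 'a \<Rightarrow> bool" where
  "right_identity Q e \<longleftrightarrow> e \<in> carrier Q \<and>
     (\<forall>x\<in>carrier Q. mult Q x e \<noteq> None \<longrightarrow> mult Q x e = Some x)"

definition constellation :: "('a, 'b) pstruct_scheme \<Rightarrow> bool" where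
  "constellation Q \<longleftrightarrow> partial_op Q \<and>
     (\<forall>x\<in>carrier Q. \<forall>y\<in>carrier Q. \<forall>z\<in>carrier Q.
        mult_r Q x y z \<noteq> None \<longrightarrow> mult_l Q x y z \<noteq> None \<and> mult_r Q x y z = mult_l Q x y z) \<and>
     (\<forall>x\<in>carrier Q. \<forall>y\<in>carrier Q. \<forall>z\<in>carrier Q.
        mult Q x y \<noteq> None \<and> mult Q y z \<noteq> None \<longrightarrow> mult_r Q x y z \<noteq> None) \<and>
     (\<forall>x\<in>carrier Q. \<exists>!e. right_identity Q e \<and> mult Q e x = Some x)"

definition con_dom :: "('a, 'b) pstruct_scheme \<Rightarrow> 'a \<Rightarrow> 'a" where
  "con_dom Q x = (THE e. right_identity Q e \<and> mult Q e x = Some x)"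

definition con_doms :: "('a, 'b) pstruct_scheme \<Rightarrow> 'a set" where
  "con_doms Q = con_dom Q ` carrier Q"

definition con_le :: "('a, 'b) pstruct_scheme \<Rightarrow> 'a \<Rightarrow> 'a \<Rightarrow> bool" where
  "con_le Q e f \<longleftrightarrow> mult Q e f \<noteq> None"

definition ran_set :: "('a, 'b) pstruct_scheme \<Rightarrow> 'a \<Rightarrow> 'a set" where
  "ran_set Q s = {e \<in> con_doms Q. mult Q s e \<noteq> None \<and>
     (\<forall>f\<in>con_doms Q. mult Q s f \<noteq> None \<longrightarrow> con_le Q e f)}"

definition con_ran :: "('a, 'b) pstruct_scheme \<Rightarrow> 'a \<Rightarrow> 'a" where
  "con_ran Q s = (THE e. e \<in> ran_set Q s)"

definition constellation_with_range :: "('a, 'b) pstruct_scheme \<Rightarrow> bool" where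
  "constellation_with_range Q \<longleftrightarrow> constellation Q \<and>
     (\<forall>s\<in>carrier Q. \<exists>!e. e \<in> ran_set Q s) \<and>
     (\<forall>s\<in>carrier Q. \<forall>t\<in>carrier Q. \<forall>u. mult Q s t = Some u \<longrightarrow>
        (\<exists>v. mult Q (con_ran Q s) t = Some v \<and> con_ran Q v = con_ran Q u))"

definition left_cancellative :: "('a, 'b) pstruct_scheme \<Rightarrow> bool" where
  "left_cancellative Q \<longleftrightarrow>
     (\<forall>a\<in>carrier Q. \<forall>b\<in>carrier Q. \<forall>c\<in>carrier Q.
        mult Q a b \<noteq> None \<and> mult Q a b = mult Q a c \<longrightarrow>
        mult Q (con_ran Q a) b \<noteq> None \<and> mult Q (con_ran Q a) b = mult Q (con_ran Q a) c)"

definition range_radiant ::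
    "('a, 'c) pstruct_scheme \<Rightarrow> ('b, 'd) pstruct_scheme \<Rightarrow> ('a \<Rightarrow> 'b) \<Rightarrow> bool" where
  "range_radiant Q1 Q2 \<rho> \<longleftrightarrow> \<rho> \<in> carrier Q1 \<rightarrow>\<^sub>E carrier Q2 \<and>
     (\<forall>s\<in>carrier Q1. con_dom Q2 (\<rho> s) = \<rho> (con_dom Q1 s) \<and> con_ran Q2 (\<rho> s) = \<rho> (con_ran Q1 s)) \<and>
     (\<forall>s\<in>carrier Q1. \<forall>t\<in>carrier Q1. \<forall>u.
        mult Q1 s t = Some u \<longrightarrow> mult Q2 (\<rho> s) (\<rho> t) = Some (\<rho> u))"


section \<open>IS-categories\<close>

record 'a IS_struct = "'a pstruct" +
  I_part :: "'a set"
  S_part :: "'a set"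

definition IS_category :: "('a, 'b) IS_struct_scheme \<Rightarrow> bool" where
  "IS_category C \<longleftrightarrow> of_category C \<and>
     subcategory C (I_part C) \<and> cat_doms C \<subseteq> I_part C \<and>
     subcategory C (S_part C) \<and> cat_doms C \<subseteq> S_part C \<and>
     (\<forall>e\<in>cat_doms C. \<forall>f\<in>cat_doms C. \<exists>\<^sub>\<le>\<^sub>1 i. i \<in> I_part C \<and>
        ((cat_dom C i = e \<and> cat_ran C i = f) \<or> (cat_dom C i = f \<and> cat_ran C i = e))) \<and>
     (\<forall>a\<in>carrier C. \<exists>!p. fst p \<in> S_part C \<and> snd p \<in> I_part C \<and>
        mult C (fst p) (snd p) = Some a)"

definition regular :: "('a, 'b) IS_struct_scheme \<Rightarrow> bool" where
  "regular C \<longleftrightarrow> (\<forall>s\<in>S_part C. epimorphism C s)"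

definition IS_functor ::
    "('a, 'c) IS_struct_scheme \<Rightarrow> ('b, 'd) IS_struct_scheme \<Rightarrow> ('a \<Rightarrow> 'b) \<Rightarrow> bool" where
  "IS_functor C1 C2 F \<longleftrightarrow> of_functor C1 C2 F \<and>
     F ` I_part C1 \<subseteq> I_part C2 \<and> F ` S_part C1 \<subseteq> S_part C2"


section \<open>The canonical extension of a constellation with range\<close>

text \<open>
  The ordered pair of \<open>s\<close> and \<open>e\<close> is \<open>pr (s, e)\<close> for an injective \<open>pr\<close>. With \<open>pr\<close> of type
  \<open>'u \<times> 'u \<Rightarrow> 'u\<close>, a type \<open>'u\<close> is a universe of discourse closed under ordered pairs, whose
  subsets are the classes: the canonical extension of a constellation in this universe is again a class
  of the same universe.
\<close>

definition can_carrier :: "('a \<times> 'a \<Rightarrow> 'b) \<Rightarrow> ('a, 'c) pstruct_scheme \<Rightarrow> 'b set" where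
  "can_carrier pr Q =
     {pr (s, e) | s e. s \<in> carrier Q \<and> e \<in> con_doms Q \<and> mult Q s e \<noteq> None}"

definition can_mult ::
    "('a \<times> 'a \<Rightarrow> 'b) \<Rightarrow> ('a, 'c) pstruct_scheme \<Rightarrow> 'b \<Rightarrow> 'b \<Rightarrow> 'b option" where
  "can_mult pr Q x y =
     (let (s, e) = inv pr x; (t, f) = inv pr y in
      if x \<in> can_carrier pr Q \<and> y \<in> can_carrier pr Q \<and> e = con_dom Q t
      then map_option (\<lambda>u. pr (u, f)) (mult Q s t) else None)"

definition canonical_extension ::
    "('a \<times> 'a \<Rightarrow> 'b) \<Rightarrow> ('a, 'c) pstruct_scheme \<Rightarrow> 'b IS_struct" where
  "canonical_extension pr Q =
     \<lparr>carrier = can_carrier pr Q,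
      mult = can_mult pr Q,
      I_part = {pr (e, f) | e f. e \<in> con_doms Q \<and> f \<in> con_doms Q \<and> mult Q e f \<noteq> None},
      S_part = {pr (s, con_ran Q s) | s. s \<in> carrier Q}\<rparr>"

definition can_map ::
    "('a \<times> 'a \<Rightarrow> 'b) \<Rightarrow> ('a, 'c) pstruct_scheme \<Rightarrow> ('a \<Rightarrow> 'a) \<Rightarrow> 'b \<Rightarrow> 'b" where
  "can_map pr P \<rho> = (\<lambda>x\<in>can_carrier pr P. let (s, e) = inv pr x in pr (\<rho> s, \<rho> e))"


section \<open>The constellation of an IS-category\<close>

definition I_le :: "('a, 'b) IS_struct_scheme \<Rightarrow> 'a \<Rightarrow> 'a \<Rightarrow> bool" where
  "I_le C s t \<longleftrightarrow> (\<exists>i\<in>I_part C. \<exists>j\<in>I_part C. mult C s i \<noteq> None \<and> mult C s i = mult C j t)"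

definition I_restrict :: "('a, 'b) IS_struct_scheme \<Rightarrow> 'a \<Rightarrow> 'a \<Rightarrow> 'a" where
  "I_restrict C e s = (THE x. x \<in> S_part C \<and> I_le C x s \<and> cat_dom C x = e)"

text \<open>The \<open>D\<close> and \<open>R\<close> of the constellation are determined by its product; on \<open>S_part C\<close> they agree with those of \<open>C\<close>.\<close>

definition S_constellation :: "('a, 'b) IS_struct_scheme \<Rightarrow> 'a pstruct" where
  "S_constellation C =
     \<lparr>carrier = S_part C,
      mult = (\<lambda>s t. if s \<in> S_part C \<and> t \<in> S_part C \<and> I_le C (cat_ran C s) (cat_dom C t)
                     then mult C s (I_restrict C (cat_ran C s) t) else None)\<rparr>"


section \<open>Categories with objects and arrows, functors, natural isomorphisms\<close>

text \<open>\<open>Comp K f g\<close> is \<open>f\<close> followed by \<open>g\<close>; it is relevant only if the codomain of \<open>f\<close> is the domain of \<open>g\<close>.\<close>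

record ('o, 'm) oa_cat =
  Obj :: "'o set"
  Arr :: "'m set"
  Dom :: "'m \<Rightarrow> 'o"
  Cod :: "'m \<Rightarrow> 'o"
  Id :: "'o \<Rightarrow> 'm"
  Comp :: "'m \<Rightarrow> 'm \<Rightarrow> 'm"

definition oa_category :: "('o, 'm) oa_cat \<Rightarrow> bool" where
  "oa_category K \<longleftrightarrow>
     (\<forall>f\<in>Arr K. Dom K f \<in> Obj K \<and> Cod K f \<in> Obj K) \<and>
     (\<forall>A\<in>Obj K. Id K A \<in> Arr K \<and> Dom K (Id K A) = A \<and> Cod K (Id K A) = A) \<and>
     (\<forall>f\<in>Arr K. \<forall>g\<in>Arr K. Cod K f = Dom K g \<longrightarrow>
        Comp K f g \<in> Arr K \<and> Dom K (Comp K f g) = Dom K f \<and> Cod K (Comp K f g) = Cod K g) \<and>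
     (\<forall>f\<in>Arr K. Comp K (Id K (Dom K f)) f = f \<and> Comp K f (Id K (Cod K f)) = f) \<and>
     (\<forall>f\<in>Arr K. \<forall>g\<in>Arr K. \<forall>h\<in>Arr K. Cod K f = Dom K g \<and> Cod K g = Dom K h \<longrightarrow>
        Comp K (Comp K f g) h = Comp K f (Comp K g h))"

record ('o1, 'm1, 'o2, 'm2) oa_map =
  on_obj :: "'o1 \<Rightarrow> 'o2"
  on_arr :: "'m1 \<Rightarrow> 'm2"

definition oa_functor ::
    "('o1, 'm1) oa_cat \<Rightarrow> ('o2, 'm2) oa_cat \<Rightarrow> ('o1, 'm1, 'o2, 'm2) oa_map \<Rightarrow> bool" where
  "oa_functor K L F \<longleftrightarrow> oa_category K \<and> oa_category L \<and>
     (\<forall>A\<in>Obj K. on_obj F A \<in> Obj L \<and> on_arr F (Id K A) = Id L (on_obj F A)) \<and>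
     (\<forall>f\<in>Arr K. on_arr F f \<in> Arr L \<and>
        Dom L (on_arr F f) = on_obj F (Dom K f) \<and> Cod L (on_arr F f) = on_obj F (Cod K f)) \<and>
     (\<forall>f\<in>Arr K. \<forall>g\<in>Arr K. Cod K f = Dom K g \<longrightarrow>
        on_arr F (Comp K f g) = Comp L (on_arr F f) (on_arr F g))"

definition id_functor :: "('o, 'm, 'o, 'm) oa_map" where
  "id_functor = \<lparr>on_obj = id, on_arr = id\<rparr>"

text \<open>Composites of functors are read left to right as well: \<open>F\<close> is applied first.\<close>

definition comp_functor ::
    "('o1, 'm1, 'o2, 'm2) oa_map \<Rightarrow> ('o2, 'm2, 'o3, 'm3) oa_map \<Rightarrow> ('o1, 'm1, 'o3, 'm3) oa_map"
    (infixl \<open>;;\<close> 55) where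
  "F ;; G = \<lparr>on_obj = (\<lambda>A. on_obj G (on_obj F A)), on_arr = (\<lambda>f. on_arr G (on_arr F f))\<rparr>"

definition oa_iso :: "('o, 'm) oa_cat \<Rightarrow> 'm \<Rightarrow> bool" where
  "oa_iso K f \<longleftrightarrow> f \<in> Arr K \<and>
     (\<exists>g\<in>Arr K. Dom K g = Cod K f \<and> Cod K g = Dom K f \<and>
        Comp K f g = Id K (Dom K f) \<and> Comp K g f = Id K (Cod K f))"

definition natural_iso ::
    "('o1, 'm1) oa_cat \<Rightarrow> ('o2, 'm2) oa_cat \<Rightarrow> ('o1, 'm1, 'o2, 'm2) oa_map \<Rightarrow>
     ('o1, 'm1, 'o2, 'm2) oa_map \<Rightarrow> ('o1 \<Rightarrow> 'm2) \<Rightarrow> bool" where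
  "natural_iso K L F G \<eta> \<longleftrightarrow> oa_functor K L F \<and> oa_functor K L G \<and>
     (\<forall>A\<in>Obj K. oa_iso L (\<eta> A) \<and> Dom L (\<eta> A) = on_obj F A \<and> Cod L (\<eta> A) = on_obj G A) \<and>
     (\<forall>f\<in>Arr K. Comp L (on_arr F f) (\<eta> (Cod K f)) = Comp L (\<eta> (Dom K f)) (on_arr G f))"

definition equivalent_categories ::
    "('o1, 'm1) oa_cat \<Rightarrow> ('o2, 'm2) oa_cat \<Rightarrow> ('o1, 'm1, 'o2, 'm2) oa_map \<Rightarrow>
     ('o2, 'm2, 'o1, 'm1) oa_map \<Rightarrow> bool" where
  "equivalent_categories K L F G \<longleftrightarrow> oa_functor K L F \<and> oa_functor L K G \<and>
     (\<exists>\<eta>. natural_iso K K id_functor (F ;; G) \<eta>) \<and>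
     (\<exists>\<tau>. natural_iso L L id_functor (G ;; F) \<tau>)"


section \<open>The two categories and the two functors\<close>

text \<open>An arrow is a function together with its source and target.\<close>

type_synonym ('o, 'a) arrow = "'o \<times> ('a \<Rightarrow> 'a) \<times> 'o"

definition arrow_fun :: "('o, 'a) arrow \<Rightarrow> 'a \<Rightarrow> 'a" where
  "arrow_fun f = fst (snd f)"

definition concrete_cat ::
    "'o set \<Rightarrow> ('o \<Rightarrow> 'a set) \<Rightarrow> ('o \<Rightarrow> 'o \<Rightarrow> ('a \<Rightarrow> 'a) \<Rightarrow> bool) \<Rightarrow> ('o, ('o, 'a) arrow) oa_cat" where
  "concrete_cat Ob U mor =
     \<lparr>Obj = Ob,
      Arr = {(P, f, Q). P \<in> Ob \<and> Q \<in> Ob \<and> mor P Q f},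
      Dom = (\<lambda>(P, f, Q). P),
      Cod = (\<lambda>(P, f, Q). Q),
      Id = (\<lambda>P. (P, (\<lambda>x\<in>U P. x), P)),
      Comp = (\<lambda>(P, f, Q) (Q', g, T). (P, compose (U P) g f, T))\<rparr>"

definition R_cat :: "('u pstruct, ('u pstruct, 'u) arrow) oa_cat" where
  "R_cat = concrete_cat {Q. constellation_with_range Q} carrier range_radiant"

definition IS_cat :: "('u IS_struct, ('u IS_struct, 'u) arrow) oa_cat" where
  "IS_cat = concrete_cat {C. IS_category C} carrier IS_functor"

definition phi ::
    "('u \<times> 'u \<Rightarrow> 'u) \<Rightarrow>
     ('u pstruct, ('u pstruct, 'u) arrow, 'u IS_struct, ('u IS_struct, 'u) arrow) oa_map" where
  "phi pr =
     \<lparr>on_obj = canonical_extension pr,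
      on_arr = (\<lambda>(P, \<rho>, Q). (canonical_extension pr P, can_map pr P \<rho>, canonical_extension pr Q))\<rparr>"

definition psi ::
    "('u IS_struct, ('u IS_struct, 'u) arrow, 'u pstruct, ('u pstruct, 'u) arrow) oa_map" where
  "psi =
     \<lparr>on_obj = S_constellation,
      on_arr = (\<lambda>(C, F, D). (S_constellation C, restrict F (S_part C), S_constellation D))\<rparr>"

end

(*
  In a constellation with range, s.t exists iff R(s) <= D(t), so everything is controlled by the order
  on D(Q). In an IS-category the elements i of I_C are determined by the pair (D(i), R(i)) and play the
  role of that order on D(C), and e|s is the S-part of the factorisation of i o s, where D(i) = e and
  R(i) = D(s). Uniqueness of factorisations makes restriction compatible with composition and with
  functors; associativity in S'_C and functoriality of psi follow. Both components of the natural
  isomorphisms are bijective morphisms whose inverses are again morphisms: an element x = s o i of C is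
  recovered from (s, R(x)) because i is determined by D(i) = R(s) and R(i) = R(x).
*)

theory Submission
  imports Defs
begin

section \<open>Categories\<close>

text \<open>One exchange rule carries the proof. In an IS-category an element of I followed by one
  of S becomes an element of S followed by one of I: \<open>j \<circ> s = (e|s) \<circ> i\<close>.
  This commuting square characterises \<open>e|s\<close>, and pasting such squares yields the laws
  of restriction. In C(Q) the square reads \<open>(e, D t) \<circ> (t, R t) = (e t, R(e t)) \<circ>
  (R(e t), R t)\<close>. So the product of S'_C records how I moves past S, which is exactly what is
  needed to compute composites of C from factorisations. Antisymmetry of the order has a different
  source on each side: uniqueness of \<open>R(e)\<close> in a constellation, and in an IS-category
  the fact that (IS1) ignores the orientation of an element of I. Each construction turns one source
  into the other. For the unit, bijectivity alone does not make the inverse a morphism: a bijective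
  radiant may create products, so the unit is also shown to reflect their existence.\<close>

definition composite :: "('a, 'b) pstruct_scheme \<Rightarrow> 'a \<Rightarrow> 'a \<Rightarrow> 'a" where
  "composite C x y = the (mult C x y)"

text \<open>
  A description of \<open>mult\<close> by total operations. It both follows from the axioms of a category, with
  \<open>D\<close> and \<open>R\<close> the functions \<open>cat_dom\<close> and \<open>cat_ran\<close>, and implies them, which then identifies
  \<open>cat_dom\<close> and \<open>cat_ran\<close> with \<open>D\<close> and \<open>R\<close> on the carrier.
\<close>

locale category_ops =
  fixes C :: "('a, 'b) pstruct_scheme"
    and D R :: "'a \<Rightarrow> 'a"
    and comp :: "'a \<Rightarrow> 'a \<Rightarrow> 'a" (infixl \<open>\<cdot>\<close> 70)
  assumes mult_eq: "mult C x y =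
      (if x \<in> carrier C \<and> y \<in> carrier C \<and> R x = D y then Some (x \<cdot> y) else None)"
    and D_closed [simp]: "x \<in> carrier C \<Longrightarrow> D x \<in> carrier C"
    and R_closed [simp]: "x \<in> carrier C \<Longrightarrow> R x \<in> carrier C"
    and D_D [simp]: "x \<in> carrier C \<Longrightarrow> D (D x) = D x"
    and R_D [simp]: "x \<in> carrier C \<Longrightarrow> R (D x) = D x"
    and D_R [simp]: "x \<in> carrier C \<Longrightarrow> D (R x) = R x"
    and R_R [simp]: "x \<in> carrier C \<Longrightarrow> R (R x) = R x"
    and D_comp_self [simp]: "x \<in> carrier C \<Longrightarrow> D x \<cdot> x = x"
    and comp_R_self [simp]: "x \<in> carrier C \<Longrightarrow> x \<cdot> R x = x"
    and comp_closed [simp]: "\<lbrakk>x \<in> carrier C; y \<in> carrier C; R x = D y\<rbrakk> \<Longrightarrow> x \<cdot> y \<in> carrier C"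
    and D_comp [simp]: "\<lbrakk>x \<in> carrier C; y \<in> carrier C; R x = D y\<rbrakk> \<Longrightarrow> D (x \<cdot> y) = D x"
    and R_comp [simp]: "\<lbrakk>x \<in> carrier C; y \<in> carrier C; R x = D y\<rbrakk> \<Longrightarrow> R (x \<cdot> y) = R y"
    and comp_assoc: "\<lbrakk>x \<in> carrier C; y \<in> carrier C; z \<in> carrier C; R x = D y; R y = D z\<rbrakk> \<Longrightarrow>
      x \<cdot> y \<cdot> z = x \<cdot> (y \<cdot> z)"
begin

lemma mult_Some_iff:
  "mult C x y = Some z \<longleftrightarrow> x \<in> carrier C \<and> y \<in> carrier C \<and> R x = D y \<and> x \<cdot> y = z"
  by (auto simp: mult_eq)

lemma cat_identity_D:
  assumes "x \<in> carrier C"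
  shows "cat_identity C (D x)"
proof -
  have "y \<cdot> D x = y" if "y \<in> carrier C" "R y = D x" for y
    using that comp_R_self [of y] by simp
  moreover have "D x \<cdot> y = y" if "y \<in> carrier C" "D x = D y" for y
    using that D_comp_self [of y] by simp
  ultimately show ?thesis
    unfolding cat_identity_def mult_eq using assms by auto
qed

lemma cat_identity_R: "x \<in> carrier C \<Longrightarrow> cat_identity C (R x)"
  by (metis R_closed D_R cat_identity_D)

text \<open>The product of \<open>D e\<close> and \<open>e\<close> exists; it is \<open>e\<close> by
  the unit law and \<open>D e\<close> because \<open>e\<close> is an identity.\<close>

lemma cat_identity_D_eq:
  assumes "cat_identity C e"
  shows "D e = e"
proof -
  have e: "e \<in> carrier C" using assms by (simp add: cat_identity_def)
  have "mult C (D e) e = Some (D e)"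
    using assms e unfolding cat_identity_def by (metis D_closed R_D mult_eq option.discI)
  thus ?thesis using e by (simp add: mult_eq)
qed

lemma cat_identity_R_eq: "cat_identity C e \<Longrightarrow> R e = e"
  by (metis R_D cat_identity_D_eq cat_identity_def)

lemma of_category: "of_category C"
proof -
  have "\<exists>e f. cat_identity C e \<and> cat_identity C f \<and> mult C e x \<noteq> None \<and> mult C x f \<noteq> None"
    if "x \<in> carrier C" for x
    by (rule exI [of _ "D x"], rule exI [of _ "R x"])
      (simp add: that cat_identity_D cat_identity_R mult_eq)
  moreover have "partial_op C"
    unfolding partial_op_def mult_Some_iff by auto
  ultimately show ?thesis
    unfolding of_category_def mult_l_def mult_r_def by (auto simp: mult_eq comp_assoc)
qed

lemma cat_dom_eq: "x \<in> carrier C \<Longrightarrow> cat_dom C x = D x"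
  unfolding cat_dom_def
  by (rule the_equality) (auto simp: cat_identity_D mult_eq split: if_splits dest: cat_identity_R_eq)

lemma cat_ran_eq: "x \<in> carrier C \<Longrightarrow> cat_ran C x = R x"
  unfolding cat_ran_def
  by (rule the_equality) (auto simp: cat_identity_R mult_eq split: if_splits dest: cat_identity_D_eq)

lemma cat_doms_eq: "cat_doms C = D ` carrier C"
  by (simp add: cat_doms_def cat_dom_eq)

end

text \<open>The existence part of (C1) does the work: units can be moved across a product, so an
  existing composite already forces its range and domain to match.\<close>

lemma category_ops_of_category:
  assumes "of_category C"
  shows "category_ops C (cat_dom C) (cat_ran C) (composite C)"
proof -
  let ?I = "cat_identity C" and ?m = "mult C" and ?U = "carrier C"
  have cl: "x \<in> ?U" "y \<in> ?U" "z \<in> ?U" if "?m x y = Some z" for x y z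
    using assms that unfolding of_category_def partial_op_def by blast+
  have bind: "mult_r C x y z = (case ?m y z of None \<Rightarrow> None | Some w \<Rightarrow> ?m x w)"
    "mult_l C x y z = (case ?m x y of None \<Rightarrow> None | Some w \<Rightarrow> ?m w z)" for x y z
    by (simp_all add: mult_r_def mult_l_def split: option.split)
  have eq: "mult_r C x y z = mult_l C x y z" if "x \<in> ?U" "y \<in> ?U" "z \<in> ?U" for x y z
  proof (cases "mult_r C x y z = None")
    case True
    thus ?thesis using assms that unfolding of_category_def by metis
  next
    case False
    thus ?thesis using assms that unfolding of_category_def by metis
  qed
  \<comment> \<open>(C2) followed by (C1). The facts \<open>ex1\<close> and \<open>ex2\<close> below
    are the two directions of the existence claim in (C1).\<close>
  have ex: "\<exists>w. ?m x v = Some w \<and> ?m u z = Some w" if "?m x y = Some u" "?m y z = Some v" for x y z u v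
  proof -
    have U: "x \<in> ?U" "y \<in> ?U" "z \<in> ?U" using cl that by blast+
    have "mult_r C x y z \<noteq> None"
      using assms U that unfolding of_category_def by (metis option.discI)
    thus ?thesis using eq [OF U] that by (auto simp: bind)
  qed
  have ex1: "\<exists>u. ?m x y = Some u" if "?m y z = Some v" "?m x v = Some w" for x y z v w
  proof -
    have "x \<in> ?U" "y \<in> ?U" "z \<in> ?U" using cl that by blast+
    from eq [OF this] show ?thesis using that by (auto simp: bind split: option.splits)
  qed
  have ex2: "\<exists>v. ?m y z = Some v" if "?m x y = Some u" "?m u z = Some w" for x y z u w
  proof -
    have "x \<in> ?U" "y \<in> ?U" "z \<in> ?U" using cl that by blast+
    from eq [OF this] show ?thesis using that by (auto simp: bind split: option.splits)
  qed
  have idU: "e \<in> ?U" if "?I e" for e using that by (simp add: cat_identity_def)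
  have idr: "u = x" if "?I e" "?m x e = Some u" for e x u
    using that cl(1) [OF that(2)] unfolding cat_identity_def by (metis option.discI option.inject)
  have idl: "u = x" if "?I e" "?m e x = Some u" for e x u
    using that cl(2) [OF that(2)] unfolding cat_identity_def by (metis option.discI option.inject)
  have exd: "\<exists>e. ?I e \<and> ?m e x = Some x" and exr: "\<exists>e. ?I e \<and> ?m x e = Some x" if x: "x \<in> ?U" for x
  proof -
    obtain e f u v where "?I e" "?I f" "?m e x = Some u" "?m x f = Some v"
      using assms x unfolding of_category_def by blast
    moreover from this have "u = x" "v = x" using idl idr by blast+
    ultimately show "\<exists>e. ?I e \<and> ?m e x = Some x" "\<exists>e. ?I e \<and> ?m x e = Some x" by blast+
  qed
  \<comment> \<open>Since \<open>f x = x\<close>, the product \<open>e (f x)\<close> exists, hence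
    so does \<open>e f\<close>, and it equals both of its factors.\<close>
  have und: "e = f" if e: "?I e" "?m e x = Some x" and f: "?I f" "?m f x = Some u" for e f x u
  proof -
    have "u = x" using idl f by blast
    then obtain v where v: "?m e f = Some v" using ex1 [OF f(2)] e(2) by blast
    show ?thesis using idr [OF f(1) v] idl [OF e(1) v] by simp
  qed
  have unr: "e = f" if e: "?I e" "?m x e = Some x" and f: "?I f" "?m x f = Some u" for e f x u
  proof -
    have "u = x" using idr f by blast
    then obtain v where v: "?m e f = Some v" using ex2 [OF e(2)] f(2) by blast
    show ?thesis using idr [OF f(1) v] idl [OF e(1) v] by simp
  qed
  have Deq: "cat_dom C x = e" if e: "?I e" "?m e x = Some x" for e x
    unfolding cat_dom_def by (rule the_equality) (simp add: e, metis und [OF e] option.exhaust)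
  have Req: "cat_ran C x = e" if e: "?I e" "?m x e = Some x" for e x
    unfolding cat_ran_def by (rule the_equality) (simp add: e, metis unr [OF e] option.exhaust)
  have D: "?I (cat_dom C x)" "?m (cat_dom C x) x = Some x" if x: "x \<in> ?U" for x
    using exd [OF x] Deq by auto
  have R: "?I (cat_ran C x)" "?m x (cat_ran C x) = Some x" if x: "x \<in> ?U" for x
    using exr [OF x] Req by auto
  have idid: "?m e e = Some e" if e: "?I e" for e
  proof -
    obtain f where f: "?I f" "?m f e = Some e" using exd [OF idU [OF e]] by blast
    show ?thesis using idr [OF e f(2)] f(2) by simp
  qed
  have Did: "cat_dom C e = e" and Rid: "cat_ran C e = e" if "?I e" for e
    using Deq Req idid that by blast+
  \<comment> \<open>As \<open>y = D(y) y\<close>, existence of \<open>x y\<close> gives that of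
    \<open>x D(y)\<close>, so \<open>D(y)\<close> is the right unit of \<open>x\<close>.\<close>
  have RD: "cat_ran C x = cat_dom C y" if m: "?m x y = Some z" for x y z
  proof -
    have U: "x \<in> ?U" "y \<in> ?U" using cl m by blast+
    obtain u where u: "?m x (cat_dom C y) = Some u"
      using ex1 [OF D(2) [OF U(2)] m] by blast
    show ?thesis using Req [OF D(1) [OF U(2)]] u idr [OF D(1) [OF U(2)] u] by simp
  qed
  have comp: "\<exists>z. ?m x y = Some z" if U: "x \<in> ?U" "y \<in> ?U" and e: "cat_ran C x = cat_dom C y" for x y
    using ex [OF R(2) [OF U(1)]] D(2) [OF U(2)] e by metis
  have Dm: "cat_dom C z = cat_dom C x" if m: "?m x y = Some z" for x y z
  proof -
    have U: "x \<in> ?U" using cl m by blast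
    have "?m (cat_dom C x) z = Some z" using ex [OF D(2) [OF U] m] m by auto
    thus ?thesis using Deq D(1) [OF U] by blast
  qed
  have Rm: "cat_ran C z = cat_ran C y" if m: "?m x y = Some z" for x y z
  proof -
    have U: "y \<in> ?U" using cl m by blast
    have "?m z (cat_ran C y) = Some z" using ex [OF m R(2) [OF U]] m by auto
    thus ?thesis using Req R(1) [OF U] by blast
  qed
  have mult: "?m x y = (if x \<in> ?U \<and> y \<in> ?U \<and> cat_ran C x = cat_dom C y then Some (composite C x y) else None)"
    for x y
  proof (cases "?m x y")
    case None
    thus ?thesis using comp [of x y] by auto
  next
    case (Some z)
    thus ?thesis using RD cl by (auto simp: composite_def)
  qed
  have Some: "?m x y = Some (composite C x y)" if "x \<in> ?U" "y \<in> ?U" "cat_ran C x = cat_dom C y" for x y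
    using that by (subst mult) simp
  have closed: "composite C x y \<in> ?U" "cat_dom C (composite C x y) = cat_dom C x"
    "cat_ran C (composite C x y) = cat_ran C y"
    if "x \<in> ?U" "y \<in> ?U" "cat_ran C x = cat_dom C y" for x y
    using Some [OF that] cl(3) Dm Rm by blast+
  have assoc: "composite C (composite C x y) z = composite C x (composite C y z)"
    if "x \<in> ?U" "y \<in> ?U" "z \<in> ?U" "cat_ran C x = cat_dom C y" "cat_ran C y = cat_dom C z" for x y z
    using ex [OF Some Some, of x y z] that by (auto simp: composite_def)
  show ?thesis
    by (rule category_ops.intro) (rule mult closed assoc; assumption
      | use D R Did Rid idU in \<open>simp add: composite_def\<close>)+
qed

section \<open>Constellations with range\<close>

text \<open>Used in both directions, like the description of categories above: every constellation
  with range satisfies it, and it certifies S'_C. The order is a parameter because in S'_C it is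
  \<open>I_le\<close>. Its laws are asked only for projections, the \<open>e\<close> with
  \<open>D e = e\<close>, since on other elements \<open>con_le\<close> merely says that a product
  exists.\<close>

locale ranged_constellation_ops =
  fixes Q :: "('a, 'b) pstruct_scheme"
    and D R :: "'a \<Rightarrow> 'a"
    and comp :: "'a \<Rightarrow> 'a \<Rightarrow> 'a" (infixl \<open>\<cdot>\<close> 70)
    and le :: "'a \<Rightarrow> 'a \<Rightarrow> bool" (infix \<open>\<preceq>\<close> 50)
  assumes mult_eq: "mult Q s t =
      (if s \<in> carrier Q \<and> t \<in> carrier Q \<and> R s \<preceq> D t then Some (s \<cdot> t) else None)"
    and D_closed [simp]: "s \<in> carrier Q \<Longrightarrow> D s \<in> carrier Q"
    and R_closed [simp]: "s \<in> carrier Q \<Longrightarrow> R s \<in> carrier Q"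
    and D_D [simp]: "s \<in> carrier Q \<Longrightarrow> D (D s) = D s"
    and R_D [simp]: "s \<in> carrier Q \<Longrightarrow> R (D s) = D s"
    and D_R [simp]: "s \<in> carrier Q \<Longrightarrow> D (R s) = R s"
    and R_R [simp]: "s \<in> carrier Q \<Longrightarrow> R (R s) = R s"
    and le_refl [simp]: "\<lbrakk>e \<in> carrier Q; D e = e\<rbrakk> \<Longrightarrow> e \<preceq> e"
    and le_trans: "\<lbrakk>e \<preceq> f; f \<preceq> g; e \<in> carrier Q; f \<in> carrier Q; g \<in> carrier Q;
      D e = e; D f = f; D g = g\<rbrakk> \<Longrightarrow> e \<preceq> g"
    and le_antisym: "\<lbrakk>e \<preceq> f; f \<preceq> e; e \<in> carrier Q; f \<in> carrier Q; D e = e; D f = f\<rbrakk> \<Longrightarrow> e = f"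
    and D_comp_self [simp]: "s \<in> carrier Q \<Longrightarrow> D s \<cdot> s = s"
    and comp_proj [simp]: "\<lbrakk>s \<in> carrier Q; e \<in> carrier Q; D e = e; R s \<preceq> e\<rbrakk> \<Longrightarrow> s \<cdot> e = s"
    and comp_closed [simp]: "\<lbrakk>s \<in> carrier Q; t \<in> carrier Q; R s \<preceq> D t\<rbrakk> \<Longrightarrow> s \<cdot> t \<in> carrier Q"
    and D_comp [simp]: "\<lbrakk>s \<in> carrier Q; t \<in> carrier Q; R s \<preceq> D t\<rbrakk> \<Longrightarrow> D (s \<cdot> t) = D s"
    and R_comp: "\<lbrakk>s \<in> carrier Q; t \<in> carrier Q; R s \<preceq> D t\<rbrakk> \<Longrightarrow> R (R s \<cdot> t) = R (s \<cdot> t)"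
    and R_comp_le: "\<lbrakk>s \<in> carrier Q; t \<in> carrier Q; R s \<preceq> D t\<rbrakk> \<Longrightarrow> R (s \<cdot> t) \<preceq> R t"
    and comp_assoc: "\<lbrakk>s \<in> carrier Q; t \<in> carrier Q; u \<in> carrier Q; R s \<preceq> D t; R t \<preceq> D u\<rbrakk> \<Longrightarrow>
      s \<cdot> t \<cdot> u = s \<cdot> (t \<cdot> u)"
begin

lemma mult_Some_iff:
  "mult Q s t = Some u \<longleftrightarrow> s \<in> carrier Q \<and> t \<in> carrier Q \<and> R s \<preceq> D t \<and> s \<cdot> t = u"
  by (auto simp: mult_eq)

lemma R_comp_le_D:
  assumes "s \<in> carrier Q" "t \<in> carrier Q" "u \<in> carrier Q" "R s \<preceq> D t" "R t \<preceq> D u"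
  shows "R (s \<cdot> t) \<preceq> D u"
  by (rule le_trans [OF R_comp_le [of s t]]) (use assms in simp_all)

lemma comp_R_self [simp]: "s \<in> carrier Q \<Longrightarrow> s \<cdot> R s = s"
  by simp

lemma R_proj: "\<lbrakk>e \<in> carrier Q; D e = e\<rbrakk> \<Longrightarrow> R e = e"
  by (metis R_D)

text \<open>The product \<open>D(e) e\<close> is \<open>e\<close> by the unit law, and it is
  \<open>D(e)\<close> because \<open>e\<close> is a right identity.\<close>

lemma right_identity_iff: "right_identity Q e \<longleftrightarrow> e \<in> carrier Q \<and> D e = e"
proof
  assume r: "right_identity Q e"
  hence e: "e \<in> carrier Q" by (simp add: right_identity_def)
  have m: "mult Q (D e) e = Some e" using e by (simp add: mult_eq)
  have "mult Q (D e) e = Some (D e)"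
    using r D_closed [OF e] m unfolding right_identity_def by (metis option.discI)
  thus "e \<in> carrier Q \<and> D e = e" using e m by simp
next
  assume "e \<in> carrier Q \<and> D e = e"
  thus "right_identity Q e" by (auto simp: right_identity_def mult_eq)
qed

lemma right_identity_left_unit_iff:
  assumes "x \<in> carrier Q"
  shows "right_identity Q e \<and> mult Q e x = Some x \<longleftrightarrow> e = D x"
proof
  assume "right_identity Q e \<and> mult Q e x = Some x"
  hence e: "e \<in> carrier Q" "D e = e" "R e \<preceq> D x" "e \<cdot> x = x"
    by (auto simp: right_identity_iff mult_Some_iff)
  show "e = D x" using D_comp [OF e(1) assms e(3)] e by simp
qed (use assms in \<open>simp add: right_identity_iff mult_eq\<close>)

lemma con_dom_eq: "x \<in> carrier Q \<Longrightarrow> con_dom Q x = D x"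
  unfolding con_dom_def by (simp add: right_identity_left_unit_iff)

lemma con_doms_iff: "e \<in> con_doms Q \<longleftrightarrow> e \<in> carrier Q \<and> D e = e"
  unfolding con_doms_def by (force simp: image_iff con_dom_eq)

lemma con_le_iff:
  assumes "e \<in> con_doms Q" "f \<in> con_doms Q"
  shows "con_le Q e f \<longleftrightarrow> e \<preceq> f"
  using assms R_proj [of e] by (auto simp: con_le_def mult_eq con_doms_iff)

text \<open>\<open>R s\<close> is a least projection that can follow \<open>s\<close>, and
  antisymmetry leaves room for only one.\<close>

lemma ran_set_eq:
  assumes s: "s \<in> carrier Q"
  shows "ran_set Q s = {R s}"
proof -
  have Rs: "R s \<in> con_doms Q" using s by (simp add: con_doms_iff)
  have m: "mult Q s e \<noteq> None \<longleftrightarrow> R s \<preceq> e" if "e \<in> con_doms Q" for e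
    using that s by (auto simp: con_doms_iff mult_eq)
  have "e \<in> ran_set Q s \<longleftrightarrow> e = R s" for e
  proof
    assume e: "e \<in> ran_set Q s"
    have "mult Q s (R s) \<noteq> None" using s by (simp add: mult_eq)
    hence "con_le Q e (R s)" "e \<in> con_doms Q" "R s \<preceq> e"
      using e Rs m by (auto simp: ran_set_def)
    thus "e = R s" using s con_le_iff [OF _ Rs] by (auto simp: con_doms_iff intro: le_antisym)
  next
    assume "e = R s"
    thus "e \<in> ran_set Q s" using Rs s m con_le_iff [OF Rs] by (simp add: ran_set_def)
  qed
  thus ?thesis by blast
qed

lemma con_ran_eq: "s \<in> carrier Q \<Longrightarrow> con_ran Q s = R s"
  by (simp add: con_ran_def ran_set_eq)

text \<open>Associativity is one-sided because \<open>s (t u)\<close> requires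
  \<open>R t \<le> D u\<close>, whereas \<open>(s t) u\<close> requires only the weaker
  \<open>R(s t) \<le> D u\<close>.\<close>

lemma constellation: "constellation Q"
proof -
  have "mult_l Q x y z \<noteq> None \<and> mult_r Q x y z = mult_l Q x y z"
    if U: "x \<in> carrier Q" "y \<in> carrier Q" "z \<in> carrier Q" and m: "mult_r Q x y z \<noteq> None" for x y z
  proof -
    have yz: "R y \<preceq> D z" and "R x \<preceq> D (y \<cdot> z)"
      using m U by (auto simp: mult_r_def mult_eq split: if_splits)
    hence xy: "R x \<preceq> D y" using U by simp
    show ?thesis using U xy yz
      by (simp add: mult_r_def mult_l_def mult_eq R_comp_le_D comp_assoc)
  qed
  moreover have "mult_r Q x y z \<noteq> None"
    if U: "x \<in> carrier Q" "y \<in> carrier Q" "z \<in> carrier Q"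
      and m: "mult Q x y \<noteq> None \<and> mult Q y z \<noteq> None" for x y z
  proof -
    have "R x \<preceq> D y" "R y \<preceq> D z" using m by (auto simp: mult_eq split: if_splits)
    thus ?thesis using U by (simp add: mult_r_def mult_eq)
  qed
  moreover have "\<exists>!e. right_identity Q e \<and> mult Q e x = Some x" if "x \<in> carrier Q" for x
    using that by (simp add: right_identity_left_unit_iff)
  moreover have "partial_op Q"
    unfolding partial_op_def mult_Some_iff by auto
  ultimately show ?thesis unfolding constellation_def by blast
qed

lemma constellation_with_range: "constellation_with_range Q"
proof -
  have "\<exists>v. mult Q (con_ran Q s) t = Some v \<and> con_ran Q v = con_ran Q u"
    if "mult Q s t = Some u" for s t u
  proof -
    have st: "s \<in> carrier Q" "t \<in> carrier Q" "R s \<preceq> D t" "s \<cdot> t = u"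
      using that by (simp_all add: mult_Some_iff)
    have "mult Q (R s) t = Some (R s \<cdot> t)" using st by (simp add: mult_eq)
    moreover have "con_ran Q (R s \<cdot> t) = con_ran Q u" using st R_comp [of s t] by (auto simp: con_ran_eq)
    ultimately show ?thesis using st by (simp add: con_ran_eq)
  qed
  moreover have "\<exists>!e. e \<in> ran_set Q s" if "s \<in> carrier Q" for s
    using ran_set_eq [OF that] by simp
  ultimately show ?thesis
    unfolding constellation_with_range_def using constellation by blast
qed

end

text \<open>The point is that existence of \<open>s t\<close> depends only on \<open>R s\<close> and
  \<open>D t\<close>: since \<open>t = D(t) t\<close>, the factor \<open>t\<close> may be replaced
  by \<open>D t\<close>, and \<open>R s\<close> is least among the projections that can follow
  \<open>s\<close>.\<close>

lemma ranged_constellation_ops_of_constellation_with_range: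
  assumes "constellation_with_range Q"
  shows "ranged_constellation_ops Q (con_dom Q) (con_ran Q) (composite Q) (con_le Q)"
proof -
  let ?m = "mult Q" and ?U = "carrier Q" and ?D = "con_dom Q" and ?R = "con_ran Q"
  have con: "constellation Q" using assms by (simp add: constellation_with_range_def)
  have cl: "x \<in> ?U" "y \<in> ?U" "z \<in> ?U" if "?m x y = Some z" for x y z
    using con that unfolding constellation_def partial_op_def by blast+
  have q2: "\<exists>w. ?m x v = Some w \<and> ?m u z = Some w"
    if "?m x y = Some u" "?m y z = Some v" for x y z u v
  proof -
    have U: "x \<in> ?U" "y \<in> ?U" "z \<in> ?U" using cl that by blast+
    have "mult_r Q x y z \<noteq> None"
      using con U that unfolding constellation_def by (metis option.discI)
    moreover from this have "mult_r Q x y z = mult_l Q x y z"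
      using con U unfolding constellation_def by blast
    ultimately show ?thesis using that by (auto simp: mult_r_def mult_l_def)
  qed
  have q1: "\<exists>u. ?m x y = Some u \<and> ?m u z = Some w"
    if "?m y z = Some v" "?m x v = Some w" for x y z v w
  proof -
    have U: "x \<in> ?U" "y \<in> ?U" "z \<in> ?U" using cl that by blast+
    have "mult_r Q x y z = Some w" using that by (simp add: mult_r_def)
    hence "mult_l Q x y z = Some w"
      using con U unfolding constellation_def by (metis option.discI)
    thus ?thesis by (auto simp: mult_l_def split: bind_splits)
  qed
  have rid: "u = x" if "right_identity Q e" "?m x e = Some u" for e x u
    using that cl(1) [OF that(2)] unfolding right_identity_def by (metis option.discI option.inject)
  have D: "right_identity Q (?D x)" "?m (?D x) x = Some x" if x: "x \<in> ?U" for x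
  proof -
    have "\<exists>!e. right_identity Q e \<and> ?m e x = Some x"
      using con x unfolding constellation_def by blast
    from theI' [OF this] show "right_identity Q (?D x)" "?m (?D x) x = Some x"
      unfolding con_dom_def by blast+
  qed
  have Deq: "?D x = e" if "right_identity Q e" "?m e x = Some x" for e x
  proof -
    have x: "x \<in> ?U" using cl that by blast
    have "\<exists>!e. right_identity Q e \<and> ?m e x = Some x"
      using con x unfolding constellation_def by blast
    thus ?thesis using that D [OF x] by blast
  qed
  have DU: "?D x \<in> ?U" if "x \<in> ?U" for x using cl D(2) [OF that] by blast
  have DD: "?D e = e" if e: "right_identity Q e" for e
  proof -
    have "e \<in> ?U" using e by (simp add: right_identity_def)
    thus ?thesis using rid [OF e] D(2) by metis
  qed
  have Drid: "right_identity Q e" if "e \<in> ?U" "?D e = e" for e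
    using D [OF that(1)] that(2) by simp
  have doms: "e \<in> con_doms Q \<longleftrightarrow> e \<in> ?U \<and> ?D e = e" for e
    unfolding con_doms_def using D DD DU by (force simp: image_iff)
  have ee: "?m e e = Some e" if "e \<in> ?U" "?D e = e" for e
    using D(2) [OF that(1)] that(2) by simp
  have mD: "?m s t \<noteq> None \<longleftrightarrow> ?m s (?D t) \<noteq> None" if "s \<in> ?U" "t \<in> ?U" for s t
  proof
    assume "?m s t \<noteq> None"
    thus "?m s (?D t) \<noteq> None" using q1 [OF D(2) [OF that(2)]] by blast
  next
    assume "?m s (?D t) \<noteq> None"
    thus "?m s t \<noteq> None" using q2 [OF _ D(2) [OF that(2)]] by blast
  qed
  have Rset: "ran_set Q s = {?R s}" if "s \<in> ?U" for s
  proof -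
    have ex: "\<exists>!e. e \<in> ran_set Q s"
      using assms that unfolding constellation_with_range_def by blast
    have "?R s \<in> ran_set Q s" unfolding con_ran_def by (rule theI' [OF ex])
    thus ?thesis using ex by blast
  qed
  have RU: "?R s \<in> ?U" "?D (?R s) = ?R s" and mR: "?m s (?R s) = Some s"
    and Rle: "\<And>f. \<lbrakk>f \<in> ?U; ?D f = f; ?m s f \<noteq> None\<rbrakk> \<Longrightarrow> con_le Q (?R s) f" if s: "s \<in> ?U" for s
  proof -
    have r: "?R s \<in> ran_set Q s" using Rset [OF s] by simp
    thus "?R s \<in> ?U" "?D (?R s) = ?R s" "\<And>f. \<lbrakk>f \<in> ?U; ?D f = f; ?m s f \<noteq> None\<rbrakk> \<Longrightarrow> con_le Q (?R s) f"
      by (auto simp: ran_set_def doms)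
    thus "?m s (?R s) = Some s" using r rid [OF Drid] by (force simp: ran_set_def)
  qed
  have me: "?m s e = Some s" if s: "s \<in> ?U" and e: "e \<in> ?U" "?D e = e" and le: "con_le Q (?R s) e" for s e
  proof -
    obtain v where v: "?m (?R s) e = Some v" using le by (auto simp: con_le_def)
    obtain w where "?m s e = Some w" using q2 [OF mR [OF s] v] by blast
    thus ?thesis using rid [OF Drid [OF e]] by simp
  qed
  have mle: "?m s t \<noteq> None \<longleftrightarrow> con_le Q (?R s) (?D t)" if "s \<in> ?U" "t \<in> ?U" for s t
    unfolding mD [OF that] using Rle [OF that(1), of "?D t"] me [OF that(1), of "?D t"] DU DD D that
    by auto
  have trans: "con_le Q e g" if le: "con_le Q e f" "con_le Q f g" and f: "f \<in> ?U" "?D f = f" for e f g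
  proof -
    obtain u v where u: "?m e f = Some u" and v: "?m f g = Some v"
      using le by (auto simp: con_le_def)
    have "u = e" using rid [OF Drid [OF f] u] .
    thus ?thesis using q2 [OF u v] by (auto simp: con_le_def)
  qed
  \<comment> \<open>Both \<open>e\<close> and \<open>f\<close> are least among the projections that
    can follow \<open>e\<close>, and the range of \<open>e\<close> is unique.\<close>
  have anti: "e = f" if le: "con_le Q e f" "con_le Q f e"
    and e: "e \<in> ?U" "?D e = e" and f: "f \<in> ?U" "?D f = f" for e f
  proof -
    have "e \<in> ran_set Q e" "f \<in> ran_set Q e"
      using le e f ee [OF e] trans [OF le(2) _ e] by (auto simp: ran_set_def doms con_le_def)
    thus ?thesis using Rset [OF e(1)] by auto
  qed
  have Rproj: "?R e = e" if e: "e \<in> ?U" "?D e = e" for e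
  proof -
    have "e \<in> ran_set Q e" using e ee [OF e] by (auto simp: ran_set_def doms con_le_def)
    thus ?thesis using Rset [OF e(1)] by auto
  qed
  have Some: "?m s t = Some (composite Q s t)" if "s \<in> ?U" "t \<in> ?U" "con_le Q (?R s) (?D t)" for s t
    using mle [OF that(1,2)] that(3) by (auto simp: composite_def)
  have Dm: "?D u = ?D s" if m: "?m s t = Some u" for s t u
  proof -
    have s: "s \<in> ?U" using cl m by blast
    have "?m (?D s) u = Some u" using q2 [OF D(2) [OF s] m] m by auto
    thus ?thesis using Deq D(1) [OF s] by blast
  qed
  have Rm: "con_le Q (?R u) (?R t)" if m: "?m s t = Some u" for s t u
  proof -
    have t: "t \<in> ?U" and u: "u \<in> ?U" using cl m by blast+
    have "?m u (?R t) \<noteq> None" using q2 [OF m mR [OF t]] m by auto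
    thus ?thesis using Rle [OF u] RU [OF t] by blast
  qed
  have Rc: "?R (composite Q (?R s) t) = ?R (composite Q s t)"
    if "s \<in> ?U" "t \<in> ?U" "con_le Q (?R s) (?D t)" for s t
    using assms Some [OF that] that(1,2) unfolding constellation_with_range_def composite_def
    by (metis option.sel)
  have assoc: "composite Q (composite Q s t) u = composite Q s (composite Q t u)"
    if "s \<in> ?U" "t \<in> ?U" "u \<in> ?U" "con_le Q (?R s) (?D t)" "con_le Q (?R t) (?D u)" for s t u
    using q2 [OF Some Some, of s t u] that by (auto simp: composite_def)
  have mult: "?m s t = (if s \<in> ?U \<and> t \<in> ?U \<and> con_le Q (?R s) (?D t) then Some (composite Q s t) else None)"
    for s t
  proof (cases "?m s t")
    case None
    thus ?thesis using mle [of s t] by auto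
  next
    case Some': (Some z)
    thus ?thesis using mle [of s t] cl [OF Some'] by (auto simp: composite_def)
  qed
  show ?thesis
  \<comment> \<open>The case numbers follow the assumptions of the locale: 1 is the description of
    the product, 8 to 10 are the order laws, 12 to 17 the laws of the product.\<close>
  proof (rule ranged_constellation_ops.intro, goal_cases)
    case 1 show ?case by (rule mult)
  next
    case 8 thus ?case using ee by (simp add: con_le_def)
  next
    case 9 thus ?case using trans by blast
  next
    case 10 thus ?case using anti by blast
  next
    case 12 thus ?case using me by (simp add: composite_def)
  next
    case 13 thus ?case using Some cl by blast
  next
    case 14 thus ?case using Some Dm by blast
  next
    case 15 thus ?case by (rule Rc)
  next
    case 16 thus ?case using Some Rm by blast
  next
    case 17 thus ?case by (rule assoc)
  qed (simp_all add: composite_def D DU DD RU Rproj)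
qed

section \<open>IS-categories\<close>

locale is_category =
  fixes C :: "('a, 'b) IS_struct_scheme"
  assumes IS: "IS_category C"
begin

abbreviation "U \<equiv> carrier C"
abbreviation "S \<equiv> S_part C"
abbreviation "I \<equiv> I_part C"
abbreviation "D \<equiv> cat_dom C"
abbreviation "R \<equiv> cat_ran C"
abbreviation comp (infixl \<open>\<circ>\<circ>\<close> 70) where "x \<circ>\<circ> y \<equiv> composite C x y"

sublocale category_ops C "cat_dom C" "cat_ran C" "composite C"
  using IS by (intro category_ops_of_category) (simp add: IS_category_def)

lemma S_U: "s \<in> S \<Longrightarrow> s \<in> U" and I_U: "i \<in> I \<Longrightarrow> i \<in> U"
  using IS unfolding IS_category_def subcategory_def by blast+

lemma S_proj: "x \<in> U \<Longrightarrow> D x \<in> S" "x \<in> U \<Longrightarrow> R x \<in> S"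
  and I_proj: "x \<in> U \<Longrightarrow> D x \<in> I" "x \<in> U \<Longrightarrow> R x \<in> I"
proof -
  have *: "D x \<in> S \<and> D x \<in> I" if "x \<in> U" for x
    using IS that by (auto simp: IS_category_def cat_doms_def)
  show "x \<in> U \<Longrightarrow> D x \<in> S" "x \<in> U \<Longrightarrow> D x \<in> I" using * by blast+
  show "x \<in> U \<Longrightarrow> R x \<in> S" "x \<in> U \<Longrightarrow> R x \<in> I" using * [of "R x"] by simp_all
qed

lemma S_comp:
  assumes "s \<in> S" "t \<in> S" "R s = D t"
  shows "s \<circ>\<circ> t \<in> S"
proof -
  have "mult C s t = Some (s \<circ>\<circ> t)" using assms by (simp add: mult_eq S_U)
  thus ?thesis using IS assms unfolding IS_category_def subcategory_def by blast
qed

lemma I_comp: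
  assumes "i \<in> I" "j \<in> I" "R i = D j"
  shows "i \<circ>\<circ> j \<in> I"
proof -
  have "mult C i j = Some (i \<circ>\<circ> j)" using assms by (simp add: mult_eq I_U)
  thus ?thesis using IS assms unfolding IS_category_def subcategory_def by blast
qed

text \<open>The second alternative, with the orientation reversed, is what makes the order on
  identities antisymmetric.\<close>

lemma I_unique:
  assumes "i \<in> I" "j \<in> I" and e: "D j = D i \<and> R j = R i \<or> D j = R i \<and> R j = D i"
  shows "i = j"
proof -
  have "D i \<in> cat_doms C" "R i \<in> cat_doms C"
    using assms(1) I_U by (auto simp: cat_doms_eq image_iff intro: exI [of _ "R i"] bexI [of _ "R i"])
  hence "\<exists>\<^sub>\<le>\<^sub>1 k. k \<in> I \<and> ((D k = D i \<and> R k = R i) \<or> (D k = R i \<and> R k = D i))"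
    using IS unfolding IS_category_def by blast
  thus ?thesis using assms unfolding Uniq_def by blast
qed

lemma factor:
  assumes "x \<in> U"
  obtains s i where "s \<in> S" "i \<in> I" "R s = D i" "s \<circ>\<circ> i = x"
proof -
  have "\<exists>p. fst p \<in> S \<and> snd p \<in> I \<and> mult C (fst p) (snd p) = Some x"
    using IS assms unfolding IS_category_def by blast
  thus thesis using that unfolding mult_Some_iff by blast
qed

lemma factor_unique:
  assumes "s \<in> S" "i \<in> I" "R s = D i" "t \<in> S" "j \<in> I" "R t = D j" and eq: "s \<circ>\<circ> i = t \<circ>\<circ> j"
  shows "s = t" "i = j"
proof -
  have U: "s \<circ>\<circ> i \<in> U" using assms by (simp add: S_U I_U)
  hence "\<exists>!p. fst p \<in> S \<and> snd p \<in> I \<and> mult C (fst p) (snd p) = Some (s \<circ>\<circ> i)"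
    using IS unfolding IS_category_def by blast
  moreover have "mult C s i = Some (s \<circ>\<circ> i)" "mult C t j = Some (s \<circ>\<circ> i)"
    using assms by (simp_all add: mult_eq S_U I_U)
  ultimately have "(s, i) = (t, j)" using assms by (metis fst_conv snd_conv)
  thus "s = t" "i = j" by simp_all
qed

lemma I_le_iff: "I_le C x y \<longleftrightarrow> x \<in> U \<and> y \<in> U \<and>
    (\<exists>i\<in>I. \<exists>j\<in>I. R x = D i \<and> R j = D y \<and> x \<circ>\<circ> i = j \<circ>\<circ> y)"
proof -
  have "mult C x i \<noteq> None \<and> mult C x i = mult C j y \<longleftrightarrow>
      x \<in> U \<and> y \<in> U \<and> R x = D i \<and> R j = D y \<and> x \<circ>\<circ> i = j \<circ>\<circ> y" if "i \<in> I" "j \<in> I" for i j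
    using I_U [OF that(1)] I_U [OF that(2)] by (auto simp: mult_eq split: if_splits)
  thus ?thesis unfolding I_le_def by blast
qed

text \<open>Between identities the two witnesses of \<open>I_le\<close> coincide, because
  \<open>e i = i\<close> and \<open>j f = j\<close>. The order on D(C) thus becomes the existence of
  an arrow in I.\<close>

lemma I_le_D_iff:
  assumes "e \<in> U" "D e = e" "f \<in> U" "D f = f"
  shows "I_le C e f \<longleftrightarrow> (\<exists>i\<in>I. D i = e \<and> R i = f)"
proof
  have Re: "R e = e" and Rf: "R f = f" using assms R_D by metis+
  {
    assume "I_le C e f"
    then obtain i j where i: "i \<in> I" "R e = D i" and j: "j \<in> I" "R j = D f" "e \<circ>\<circ> i = j \<circ>\<circ> f"
      unfolding I_le_iff by blast
    have "e \<circ>\<circ> i = i" using D_comp_self [OF I_U [OF i(1)]] i(2) Re by simp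
    moreover have "j \<circ>\<circ> f = j" using comp_R_self [OF I_U [OF j(1)]] j(2) assms by simp
    ultimately have "i = j" using j(3) by simp
    thus "\<exists>i\<in>I. D i = e \<and> R i = f" using i j Re assms by auto
  next
    assume "\<exists>i\<in>I. D i = e \<and> R i = f"
    then obtain i where i: "i \<in> I" "D i = e" "R i = f" by blast
    hence "e \<circ>\<circ> i = i \<circ>\<circ> f" using D_comp_self [OF I_U [OF i(1)]] comp_R_self [OF I_U [OF i(1)]] by simp
    thus "I_le C e f" unfolding I_le_iff using assms i Re by auto
  }
qed

lemma I_le_refl: "\<lbrakk>e \<in> U; D e = e\<rbrakk> \<Longrightarrow> I_le C e e"
  unfolding I_le_D_iff by (metis I_proj(1) R_D)

lemma I_le_trans:
  assumes "I_le C e f" "I_le C f g"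
    and "e \<in> U" "f \<in> U" "g \<in> U" "D e = e" "D f = f" "D g = g"
  shows "I_le C e g"
proof -
  obtain i j where ij: "i \<in> I" "D i = e" "R i = f" "j \<in> I" "D j = f" "R j = g"
    using assms I_le_D_iff by meson
  hence "i \<circ>\<circ> j \<in> I" "D (i \<circ>\<circ> j) = e" "R (i \<circ>\<circ> j) = g"
    using I_U I_comp by auto
  thus ?thesis using assms I_le_D_iff by blast
qed

lemma I_le_antisym:
  assumes "I_le C e f" "I_le C f e" "e \<in> U" "f \<in> U" "D e = e" "D f = f"
  shows "e = f"
proof -
  obtain i j where "i \<in> I" "D i = e" "R i = f" "j \<in> I" "D j = f" "R j = e"
    using assms I_le_D_iff by meson
  thus ?thesis using I_unique [of i j] by auto
qed

lemma I_le_domain_range: "i \<in> I \<Longrightarrow> I_le C (D i) (R i)"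
  using I_le_D_iff [of "D i" "R i"] I_U by auto

section \<open>Restrictions \<open>e|s\<close> and their laws\<close>

abbreviation restr where "restr \<equiv> I_restrict C"

text \<open>Any such commuting square computes a restriction: (IS1) determines \<open>j\<close> from
  its domain and range, and then unique factorisation of \<open>j s\<close> determines
  \<open>x\<close>. Every value of a restriction below is found by exhibiting a square.\<close>

lemma I_restrict_eq:
  assumes xs: "x \<in> S" "s \<in> S" and ij: "i \<in> I" "j \<in> I" "R x = D i" "R j = D s" and eq: "x \<circ>\<circ> i = j \<circ>\<circ> s"
  shows "restr (D j) s = x"
  unfolding I_restrict_def
proof (rule the_equality)
  have U: "x \<in> U" "s \<in> U" "i \<in> U" "j \<in> U" using assms S_U I_U by blast+
  have "D x = D j" using D_comp [OF U(1,3)] D_comp [OF U(4,2)] assms by simp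
  thus "x \<in> S \<and> I_le C x s \<and> D x = D j" unfolding I_le_iff using assms U by blast
  fix y
  assume "y \<in> S \<and> I_le C y s \<and> D y = D j"
  then obtain i' j' where y: "y \<in> S" "D y = D j" "i' \<in> I" "j' \<in> I" "R y = D i'" "R j' = D s" "y \<circ>\<circ> i' = j' \<circ>\<circ> s"
    unfolding I_le_iff by blast
  hence U': "y \<in> U" "i' \<in> U" "j' \<in> U" using S_U I_U by blast+
  have "D j' = D j" using D_comp [OF U'(1,2)] D_comp [OF U'(3) U(2)] y by simp
  hence "j' = j" using I_unique [of j' j] y ij by simp
  thus "y = x" using factor_unique(1) [of y i' x i] y xs ij eq by simp
qed

text \<open>The square comes from factorising \<open>j s\<close>. Its edge \<open>i\<close> is kept
  as well, because it is what remains when \<open>j\<close> has been moved past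
  \<open>s\<close>.\<close>

lemma I_restrict:
  assumes s: "s \<in> S" and j: "j \<in> I" "R j = D s"
  obtains i where "i \<in> I" "restr (D j) s \<in> S" "D (restr (D j) s) = D j"
    "R (restr (D j) s) = D i" "R i = R s" "restr (D j) s \<circ>\<circ> i = j \<circ>\<circ> s"
proof -
  have U: "s \<in> U" "j \<in> U" using assms S_U I_U by blast+
  obtain x i where x: "x \<in> S" "i \<in> I" "R x = D i" "x \<circ>\<circ> i = j \<circ>\<circ> s"
    using factor [of "j \<circ>\<circ> s"] U j by auto
  hence U': "x \<in> U" "i \<in> U" using S_U I_U by blast+
  have "restr (D j) s = x" using I_restrict_eq x s j by blast
  moreover have "D x = D j" using D_comp [OF U'] D_comp [OF U(2,1)] j x by simp
  moreover have "R i = R s" using R_comp [OF U'] R_comp [OF U(2,1)] j x by simp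
  ultimately show thesis using that x by simp
qed

lemma I_restrict_props:
  assumes s: "s \<in> S" and e: "e \<in> U" "D e = e" "I_le C e (D s)"
  shows "restr e s \<in> S" "D (restr e s) = e" "I_le C (R (restr e s)) (R s)"
proof -
  obtain j where j: "j \<in> I" "D j = e" "R j = D s" using e s S_U I_le_D_iff [of e "D s"] by auto
  obtain i where "i \<in> I" "restr e s \<in> S" "D (restr e s) = e" "R (restr e s) = D i" "R i = R s"
    using I_restrict [OF s j(1,3)] unfolding j(2) by blast
  thus "restr e s \<in> S" "D (restr e s) = e" "I_le C (R (restr e s)) (R s)"
    using I_le_domain_range by metis+
qed

lemma I_restrict_D:
  assumes s: "s \<in> S"
  shows "restr (D s) s = s"
proof -
  have U: "s \<in> U" using s S_U by blast
  show ?thesis using I_restrict_eq [OF s s I_proj(2) [OF U] I_proj(1) [OF U]] U by simp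
qed

lemma I_restrict_proj:
  assumes "e \<in> U" "D e = e" "f \<in> U" "D f = f" "I_le C e f"
  shows "restr e f = e"
proof -
  obtain j where j: "j \<in> I" "D j = e" "R j = f" using assms I_le_D_iff by meson
  have S: "e \<in> S" "f \<in> S" using assms S_proj(1) by metis+
  have "R e = e" using assms R_D by metis
  moreover have "e \<circ>\<circ> j = j \<circ>\<circ> f"
    using D_comp_self [OF I_U [OF j(1)]] comp_R_self [OF I_U [OF j(1)]] j by simp
  ultimately show ?thesis using I_restrict_eq [OF S j(1) j(1)] j assms by simp
qed

text \<open>Two squares are pasted along \<open>i\<close>: the square of \<open>e|s\<close> leaves
  an element \<open>i\<close> of I with range \<open>D t\<close>, and this \<open>i\<close> starts
  the square that restricts \<open>t\<close>. The outer rectangle is a square for the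
  composite.\<close>

lemma I_restrict_comp:
  assumes s: "s \<in> S" and t: "t \<in> S" and st: "R s = D t" and e: "e \<in> U" "D e = e" "I_le C e (D s)"
  shows "restr e (s \<circ>\<circ> t) = restr e s \<circ>\<circ> restr (R (restr e s)) t"
proof -
  have U: "s \<in> U" "t \<in> U" using s t S_U by blast+
  obtain j where j: "j \<in> I" "D j = e" "R j = D s" using e U I_le_D_iff [of e "D s"] by auto
  obtain i where i: "i \<in> I" "restr e s \<in> S" "D (restr e s) = e" "R (restr e s) = D i" "R i = D t"
    "restr e s \<circ>\<circ> i = j \<circ>\<circ> s"
    using I_restrict [OF s j(1,3)] unfolding j(2) st by blast
  obtain k where k: "k \<in> I" "restr (D i) t \<in> S" "D (restr (D i) t) = D i"
    "R (restr (D i) t) = D k" "restr (D i) t \<circ>\<circ> k = i \<circ>\<circ> t"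
    using I_restrict [OF t i(1,5)] by blast
  note U' = U S_U [OF i(2)] S_U [OF k(2)] I_U [OF i(1)] I_U [OF j(1)] I_U [OF k(1)]
  have "restr e s \<circ>\<circ> restr (D i) t \<circ>\<circ> k = restr e s \<circ>\<circ> (i \<circ>\<circ> t)"
    using U' i k by (simp add: comp_assoc)
  also have "\<dots> = restr e s \<circ>\<circ> i \<circ>\<circ> t"
    by (rule comp_assoc [symmetric]) (use U' i in simp_all)
  also have "\<dots> = j \<circ>\<circ> (s \<circ>\<circ> t)"
    using U' i j st by (simp add: comp_assoc)
  finally have eq: "restr e s \<circ>\<circ> restr (D i) t \<circ>\<circ> k = j \<circ>\<circ> (s \<circ>\<circ> t)" .
  have "restr (D j) (s \<circ>\<circ> t) = restr e s \<circ>\<circ> restr (D i) t"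
    by (rule I_restrict_eq [OF _ _ k(1) j(1) _ _ eq])
      (use S_comp s t st i k j U' in simp_all)
  thus ?thesis using i j by simp
qed

text \<open>Here squares are stacked in the I-direction: \<open>l\<close> from \<open>e\<close> to
  \<open>f\<close> is composed with \<open>j\<close> from \<open>f\<close> to \<open>D s\<close>,
  and \<open>k\<close> with \<open>i\<close> on the opposite side.\<close>

lemma I_restrict_restrict:
  assumes s: "s \<in> S" and e: "e \<in> U" "D e = e" and f: "f \<in> U" "D f = f" and le: "I_le C e f" "I_le C f (D s)"
  shows "restr e (restr f s) = restr e s"
proof -
  obtain j where j: "j \<in> I" "D j = f" "R j = D s" using f le S_U [OF s] I_le_D_iff [of f "D s"] by auto
  obtain l where l: "l \<in> I" "D l = e" "R l = f" using e f le I_le_D_iff by meson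
  obtain i where i: "i \<in> I" "restr f s \<in> S" "D (restr f s) = f" "R (restr f s) = D i"
    "restr f s \<circ>\<circ> i = j \<circ>\<circ> s"
    using I_restrict [OF s j(1,3)] unfolding j(2) by blast
  have lf: "R l = D (restr f s)" using l i by simp
  obtain k where k: "k \<in> I" "restr e (restr f s) \<in> S" "D (restr e (restr f s)) = e"
    "R (restr e (restr f s)) = D k" "R k = R (restr f s)" "restr e (restr f s) \<circ>\<circ> k = l \<circ>\<circ> restr f s"
    using I_restrict [OF i(2) l(1) lf] unfolding l(2) by blast
  note U = S_U [OF s] I_U [OF j(1)] I_U [OF l(1)] I_U [OF i(1)] S_U [OF i(2)] I_U [OF k(1)] S_U [OF k(2)]
  have "restr e (restr f s) \<circ>\<circ> (k \<circ>\<circ> i) = l \<circ>\<circ> restr f s \<circ>\<circ> i"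
    using U i k by (simp flip: comp_assoc)
  also have "\<dots> = l \<circ>\<circ> (j \<circ>\<circ> s)"
    using U i l by (simp add: comp_assoc)
  also have "\<dots> = l \<circ>\<circ> j \<circ>\<circ> s"
    using U j l by (simp add: comp_assoc)
  finally have eq: "restr e (restr f s) \<circ>\<circ> (k \<circ>\<circ> i) = l \<circ>\<circ> j \<circ>\<circ> s" .
  have "restr (D (l \<circ>\<circ> j)) s = restr e (restr f s)"
    by (rule I_restrict_eq [OF k(2) s _ _ _ _ eq]) (use I_comp i j k l U in simp_all)
  thus ?thesis using U j l by simp
qed

section \<open>The constellation with range S'_C\<close>

lemma S_constellation_simps [simp]: "carrier (S_constellation C) = S"
  by (simp add: S_constellation_def)

text \<open>The operations \<open>D\<close> and \<open>R\<close> are those of C; this instance is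
  what allows them to be identified with the ones that S'_C defines through its own product.\<close>

sublocale S: ranged_constellation_ops "S_constellation C" "cat_dom C" "cat_ran C"
  "\<lambda>s t. s \<circ>\<circ> restr (R s) t" "I_le C"
proof (rule ranged_constellation_ops.intro, goal_cases)
  case (1 s t)
  show ?case
    using I_restrict_props [of t "R s"] S_U [of s] S_U [of t] S_U [of "restr (R s) t"]
    by (auto simp: S_constellation_def mult_eq)
next
  case (12 s e)
  thus ?case using I_restrict_proj [of "R s" e] S_U by auto
next
  case (13 s t)
  thus ?case using I_restrict_props [of t "R s"] S_U S_comp by auto
next
  case (14 s t)
  thus ?case using I_restrict_props [of t "R s"] S_U by auto
next
  \<comment> \<open>As \<open>R s\<close> is an identity of C, the product of \<open>R s\<close> and
    \<open>t\<close> in S'_C is just \<open>R(s)|t\<close>, which has the same range as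
    \<open>s \<circ> (R(s)|t)\<close>.\<close>
  case (15 s t)
  hence r: "restr (R s) t \<in> S" "D (restr (R s) t) = R s"
    using I_restrict_props [of t "R s"] S_U by auto
  thus ?case using 15 S_U by auto
next
  case (16 s t)
  thus ?case using I_restrict_props [of t "R s"] S_U by auto
next
  case (17 s t u)
  hence U: "s \<in> U" "t \<in> U" "u \<in> U" and Ru: "R t \<in> U" using S_U by auto
  let ?t = "restr (R s) t"
  have t: "?t \<in> S" "D ?t = R s" "I_le C (R ?t) (R t)" "?t \<in> U"
    using I_restrict_props [of t "R s"] 17 S_U by auto
  have u: "restr (R t) u \<in> S" "D (restr (R t) u) = R t"
    using I_restrict_props [of u "R t"] 17 U by auto
  have le: "I_le C (R ?t) (D u)"
    by (rule I_le_trans [of _ "R t"]) (use t U 17 in simp_all)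
  have v: "restr (R ?t) u \<in> S" "D (restr (R ?t) u) = R ?t" "restr (R ?t) u \<in> U"
    using I_restrict_props [of u "R ?t"] 17 U t le S_U by auto
  \<comment> \<open>The product of \<open>t\<close> and \<open>u\<close> is restricted factor by
    factor, and then the double restriction of \<open>u\<close> collapses. Associativity in C does
    the rest.\<close>
  have "restr (R s) (t \<circ>\<circ> restr (R t) u) = ?t \<circ>\<circ> restr (R ?t) (restr (R t) u)"
    using I_restrict_comp [of t "restr (R t) u" "R s"] 17 U u by simp
  also have "\<dots> = ?t \<circ>\<circ> restr (R ?t) u"
    using I_restrict_restrict [of u "R ?t" "R t"] 17 t U by simp
  finally show ?case using t U v by (simp add: comp_assoc)
qed (use S_U S_proj in \<open>auto simp: I_restrict_D I_le_refl intro: I_le_trans I_le_antisym\<close>)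

lemma constellation_with_range_S: "constellation_with_range (S_constellation C)"
  by (rule S.constellation_with_range)

text \<open>In S'_C the product of \<open>R a\<close> and \<open>b\<close> is the restriction
  \<open>R(a)|b\<close>, and this is exactly the factor that the epimorphism \<open>a\<close>
  cancels in \<open>a \<circ> (R(a)|b)\<close>.\<close>

lemma left_cancellative_S:
  assumes "regular C"
  shows "left_cancellative (S_constellation C)"
proof -
  have *: "restr (R a) b = restr (R a) c" if "a \<in> S" "b \<in> S" "c \<in> S" "I_le C (R a) (D b)" "I_le C (R a) (D c)"
    and eq: "a \<circ>\<circ> restr (R a) b = a \<circ>\<circ> restr (R a) c" for a b c
  proof -
    have b: "restr (R a) b \<in> U" "D (restr (R a) b) = R a" and c: "restr (R a) c \<in> U" "D (restr (R a) c) = R a"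
      using I_restrict_props that S_U by auto
    have "mult C a (restr (R a) b) \<noteq> None \<and> mult C a (restr (R a) b) = mult C a (restr (R a) c)"
      using b c that S_U by (simp add: mult_eq)
    thus ?thesis using assms b c that(1) unfolding regular_def epimorphism_def by blast
  qed
  thus ?thesis
    unfolding left_cancellative_def by (auto simp: S.mult_eq S.con_ran_eq S_U S_proj split: if_splits) (metis *)
qed

end

section \<open>The canonical extension\<close>

locale ranged_constellation =
  fixes Q :: "('a, 'c) pstruct_scheme"
  assumes constellation_with_range_Q: "constellation_with_range Q"
begin

abbreviation "U \<equiv> carrier Q"
abbreviation "D \<equiv> con_dom Q"
abbreviation "R \<equiv> con_ran Q"
abbreviation comp (infixl \<open>\<cdot>\<close> 70) where "x \<cdot> y \<equiv> composite Q x y"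
abbreviation le (infix \<open>\<preceq>\<close> 50) where "e \<preceq> f \<equiv> con_le Q e f"

sublocale ranged_constellation_ops Q "con_dom Q" "con_ran Q" "composite Q" "con_le Q"
  using constellation_with_range_Q by (rule ranged_constellation_ops_of_constellation_with_range)

end

locale canonical = ranged_constellation Q
  for Q :: "('a, 'c) pstruct_scheme" +
  fixes pr :: "'a \<times> 'a \<Rightarrow> 'b"
  assumes inj_pr: "inj pr"
begin

abbreviation "E \<equiv> canonical_extension pr Q"

lemma inv_pr [simp]: "inv pr (pr p) = p"
  using inj_pr by simp

lemma pr_eq_iff [simp]: "pr p = pr q \<longleftrightarrow> p = q"
  using inj_pr by (simp add: inj_eq)

lemma can_carrier_iff [simp]: "pr (s, e) \<in> can_carrier pr Q \<longleftrightarrow> s \<in> U \<and> e \<in> U \<and> D e = e \<and> R s \<preceq> e"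
  by (auto simp: can_carrier_def con_doms_iff mult_eq)

lemma carrier_E: "carrier E = can_carrier pr Q"
  by (simp add: canonical_extension_def)

lemma carrier_iff [simp]: "pr (s, e) \<in> carrier E \<longleftrightarrow> s \<in> U \<and> e \<in> U \<and> D e = e \<and> R s \<preceq> e"
  by (simp add: carrier_E)

lemma carrierE:
  assumes "x \<in> carrier E"
  obtains s e where "x = pr (s, e)" "s \<in> U" "e \<in> U" "D e = e" "R s \<preceq> e"
proof -
  obtain s e where "x = pr (s, e)" using assms unfolding carrier_E can_carrier_def by blast
  thus thesis using that assms by simp
qed

lemma I_part_iff: "x \<in> I_part E \<longleftrightarrow> (\<exists>e f. x = pr (e, f) \<and> e \<in> U \<and> f \<in> U \<and> D e = e \<and> D f = f \<and> e \<preceq> f)"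
  by (auto simp: canonical_extension_def con_doms_iff con_le_def)

lemma S_part_iff: "x \<in> S_part E \<longleftrightarrow> (\<exists>s\<in>U. x = pr (s, R s))"
  by (auto simp: canonical_extension_def)

text \<open>Elements of the extension are codes of pairs, so the operations decode with
  \<open>inv pr\<close>. Their values off the carrier are arbitrary, and no law of
  \<open>category_ops\<close> looks at them.\<close>

sublocale E: category_ops E "\<lambda>x. case inv pr x of (s, e) \<Rightarrow> pr (D s, D s)"
  "\<lambda>x. case inv pr x of (s, e) \<Rightarrow> pr (e, e)"
  "\<lambda>x y. pr (fst (inv pr x) \<cdot> fst (inv pr y), snd (inv pr y))"
proof (rule category_ops.intro, goal_cases)
  case (1 x y)
  show ?case
  proof (cases "x \<in> carrier E \<and> y \<in> carrier E")
    case True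
    then obtain s e t f where "x = pr (s, e)" "y = pr (t, f)" by (metis carrierE)
    thus ?thesis using True by (auto simp: canonical_extension_def can_mult_def mult_eq)
  next
    case False
    thus ?thesis by (auto simp: canonical_extension_def can_mult_def split: prod.splits)
  qed
next
  \<comment> \<open>Closure under composition: \<open>R(s t) \<le> R t \<le> f\<close>.\<close>
  case (10 x y)
  thus ?case by (elim carrierE) (auto intro: le_trans [OF R_comp_le])
qed (elim carrierE; auto simp: R_proj comp_assoc)+

lemma cat_dom_E [simp]: "pr (s, e) \<in> carrier E \<Longrightarrow> cat_dom E (pr (s, e)) = pr (D s, D s)"
  by (simp add: E.cat_dom_eq del: carrier_iff)

lemma cat_ran_E [simp]: "pr (s, e) \<in> carrier E \<Longrightarrow> cat_ran E (pr (s, e)) = pr (e, e)"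
  by (simp add: E.cat_ran_eq del: carrier_iff)

lemma mult_E: "mult E (pr (s, e)) (pr (t, f)) =
    (if pr (s, e) \<in> carrier E \<and> pr (t, f) \<in> carrier E \<and> e = D t then Some (pr (s \<cdot> t, f)) else None)"
  by (auto simp: E.mult_eq)

lemma cat_doms_E: "x \<in> cat_doms E \<longleftrightarrow> (\<exists>e\<in>U. D e = e \<and> x = pr (e, e))"
proof
  assume "x \<in> cat_doms E"
  thus "\<exists>e\<in>U. D e = e \<and> x = pr (e, e)"
    unfolding cat_doms_def by (auto elim!: carrierE)
next
  assume "\<exists>e\<in>U. D e = e \<and> x = pr (e, e)"
  then obtain e where e: "e \<in> U" "D e = e" "x = pr (e, e)" by blast
  hence "x \<in> carrier E" "cat_dom E x = x" by (simp_all add: R_proj)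
  thus "x \<in> cat_doms E" unfolding cat_doms_def by (metis imageI)
qed

section \<open>The canonical extension as an IS-category\<close>

lemma subcategory_I_E: "subcategory E (I_part E)"
  unfolding subcategory_def
proof (intro conjI subsetI ballI allI impI)
  fix x assume "x \<in> I_part E"
  thus "x \<in> carrier E" "cat_dom E x \<in> I_part E" "cat_ran E x \<in> I_part E"
    by (auto simp: I_part_iff R_proj)
next
  fix x y z assume "x \<in> I_part E" "y \<in> I_part E" "mult E x y = Some z"
  thus "z \<in> I_part E"
    unfolding I_part_iff by (auto simp: R_proj mult_E split: if_splits) (metis le_trans)
qed

lemma subcategory_S_E: "subcategory E (S_part E)"
  unfolding subcategory_def
proof (intro conjI subsetI ballI allI impI)
  fix x assume "x \<in> S_part E"
  thus "x \<in> carrier E" "cat_dom E x \<in> S_part E" "cat_ran E x \<in> S_part E"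
    by (auto simp: S_part_iff R_proj intro: bexI [of _ "D _"] bexI [of _ "R _"])
next
  fix x y z assume "x \<in> S_part E" "y \<in> S_part E" and z: "mult E x y = Some z"
  then obtain s t where st: "s \<in> U" "t \<in> U" "x = pr (s, R s)" "y = pr (t, R t)"
    by (auto simp: S_part_iff)
  hence z': "R s = D t" "z = pr (s \<cdot> t, R t)" using z by (auto simp: mult_E split: if_splits)
  \<comment> \<open>Because \<open>R s = D t\<close>, the product of \<open>R s\<close> and
    \<open>t\<close> is \<open>t\<close> itself, and the range axiom for \<open>s t\<close> gives
    the claim.\<close>
  hence "R (s \<cdot> t) = R t" using R_comp [of s t] st by simp
  thus "z \<in> S_part E" using z' st unfolding S_part_iff by (intro bexI [of _ "s \<cdot> t"]) auto
qed

lemma IS_category_E: "IS_category E"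
  unfolding IS_category_def
proof (intro conjI ballI)
  show "of_category E" by (rule E.of_category)
  show "subcategory E (I_part E)" by (rule subcategory_I_E)
  show "subcategory E (S_part E)" by (rule subcategory_S_E)
  show "cat_doms E \<subseteq> I_part E" by (auto simp: cat_doms_E I_part_iff)
  show "cat_doms E \<subseteq> S_part E"
    by (auto simp: cat_doms_E S_part_iff) (metis R_proj)
next
  fix x y assume "x \<in> cat_doms E" "y \<in> cat_doms E"
  then obtain e f where ef: "x = pr (e, e)" "y = pr (f, f)" by (auto simp: cat_doms_E)
  {
    fix i j
    assume "i \<in> I_part E" "j \<in> I_part E"
    then obtain a b c d where i: "i = pr (a, b)" "a \<in> U" "b \<in> U" "D a = a" "D b = b" "a \<preceq> b"
      and j: "j = pr (c, d)" "c \<in> U" "d \<in> U" "D c = c" "D d = d" "c \<preceq> d"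
      unfolding I_part_iff by blast
    assume "cat_dom E i = x \<and> cat_ran E i = y \<or> cat_dom E i = y \<and> cat_ran E i = x"
      and "cat_dom E j = x \<and> cat_ran E j = y \<or> cat_dom E j = y \<and> cat_ran E j = x"
    hence "a = e \<and> b = f \<or> a = f \<and> b = e" "c = e \<and> d = f \<or> c = f \<and> d = e"
      using i j ef by (auto simp: R_proj)
    \<comment> \<open>If \<open>i\<close> and \<open>j\<close> have opposite orientations then
      \<open>e \<le> f \<le> e\<close>, and antisymmetry gives \<open>e = f\<close>.\<close>
    hence "i = j" using i j le_antisym by auto
  }
  thus "\<exists>\<^sub>\<le>\<^sub>1 i. i \<in> I_part E \<and> (cat_dom E i = x \<and> cat_ran E i = y \<or> cat_dom E i = y \<and> cat_ran E i = x)"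
    unfolding Uniq_def by blast
next
  fix x assume "x \<in> carrier E"
  then obtain s e where x: "x = pr (s, e)" and se: "s \<in> U" "e \<in> U" "D e = e" "R s \<preceq> e" by (rule carrierE)
  show "\<exists>!p. fst p \<in> S_part E \<and> snd p \<in> I_part E \<and> mult E (fst p) (snd p) = Some x"
  \<comment> \<open>The factorisation is \<open>(s, e) = (s, R s) \<circ> (R s, e)\<close>, which
    rests on \<open>s R(s) = s\<close>.\<close>
  proof (rule ex1I [of _ "(pr (s, R s), pr (R s, e))"])
    show "fst (pr (s, R s), pr (R s, e)) \<in> S_part E \<and> snd (pr (s, R s), pr (R s, e)) \<in> I_part E \<and>
        mult E (fst (pr (s, R s), pr (R s, e))) (snd (pr (s, R s), pr (R s, e))) = Some x"
      using se x by (auto simp: S_part_iff I_part_iff mult_E)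
  next
    fix p assume p: "fst p \<in> S_part E \<and> snd p \<in> I_part E \<and> mult E (fst p) (snd p) = Some x"
    obtain t where t: "t \<in> U" "fst p = pr (t, R t)" using p by (auto simp: S_part_iff)
    obtain f g where fg: "f \<in> U" "g \<in> U" "D f = f" "snd p = pr (f, g)" using p by (auto simp: I_part_iff)
    have "mult E (pr (t, R t)) (pr (f, g)) = Some x" using p t fg by simp
    hence f: "R t = f" "x = pr (t \<cdot> f, g)" using fg by (auto simp: mult_E split: if_splits)
    \<comment> \<open>With \<open>f = R t\<close> the product of \<open>t\<close> and
      \<open>f\<close> is \<open>t\<close>, so the first component of \<open>x\<close> determines
      \<open>t\<close>.\<close>
    hence "t = s" "g = e" using x t by auto
    thus "p = (pr (s, R s), pr (R s, e))" using t fg f by (simp add: prod_eq_iff)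
  qed
qed

text \<open>Composability with \<open>(s, R s)\<close> means \<open>D t = R s = D u\<close>. Hence
  the products of \<open>R s\<close> with \<open>t\<close> and with \<open>u\<close>, which left
  cancellativity equates, are \<open>t\<close> and \<open>u\<close> themselves.\<close>

lemma regular_E:
  assumes "left_cancellative Q"
  shows "regular E"
proof -
  have *: "x = y" if xy: "x \<in> carrier E" "y \<in> carrier E" and s: "s \<in> U"
    and m: "mult E (pr (s, R s)) x \<noteq> None" "mult E (pr (s, R s)) x = mult E (pr (s, R s)) y" for s x y
  proof -
    obtain t e where x: "x = pr (t, e)" and t: "t \<in> U" using xy(1) by (rule carrierE)
    obtain u f where y: "y = pr (u, f)" and u: "u \<in> U" using xy(2) by (rule carrierE)
    have eq: "R s = D t" "R s = D u" "s \<cdot> t = s \<cdot> u" "e = f"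
      using m unfolding x y mult_E by (auto split: if_splits)
    have "mult Q s t \<noteq> None \<and> mult Q s t = mult Q s u"
      using s t u eq by (simp add: mult_eq)
    hence "mult Q (R s) t = mult Q (R s) u"
      using assms s t u unfolding left_cancellative_def by blast
    hence "R s \<cdot> t = R s \<cdot> u" by (simp add: composite_def)
    hence "t = u" using D_comp_self [OF t] D_comp_self [OF u] eq by metis
    thus "x = y" using x y eq by simp
  qed
  have "epimorphism E (pr (s, R s))" if "s \<in> U" for s
    unfolding epimorphism_def
  proof (intro conjI ballI impI)
    show "pr (s, R s) \<in> carrier E" using that by simp
  qed (use * that in blast)
  thus ?thesis
    unfolding regular_def by (auto simp: S_part_iff)
qed

end

section \<open>Morphisms\<close>

lemma range_radiantD:
  assumes "range_radiant P Q \<rho>"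
  shows "\<rho> \<in> carrier P \<rightarrow>\<^sub>E carrier Q"
    and "s \<in> carrier P \<Longrightarrow> \<rho> s \<in> carrier Q"
    and "s \<in> carrier P \<Longrightarrow> con_dom Q (\<rho> s) = \<rho> (con_dom P s)"
    and "s \<in> carrier P \<Longrightarrow> con_ran Q (\<rho> s) = \<rho> (con_ran P s)"
    and "\<lbrakk>s \<in> carrier P; t \<in> carrier P; mult P s t = Some u\<rbrakk> \<Longrightarrow> mult Q (\<rho> s) (\<rho> t) = Some (\<rho> u)"
  using assms by (auto simp: range_radiant_def)

lemma IS_functorD:
  assumes "IS_functor C1 C2 F"
  shows "F \<in> carrier C1 \<rightarrow>\<^sub>E carrier C2"
    and "x \<in> carrier C1 \<Longrightarrow> F x \<in> carrier C2"
    and "x \<in> carrier C1 \<Longrightarrow> cat_dom C2 (F x) = F (cat_dom C1 x)"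
    and "x \<in> carrier C1 \<Longrightarrow> cat_ran C2 (F x) = F (cat_ran C1 x)"
    and "\<lbrakk>x \<in> carrier C1; y \<in> carrier C1; mult C1 x y = Some z\<rbrakk> \<Longrightarrow> mult C2 (F x) (F y) = Some (F z)"
    and "i \<in> I_part C1 \<Longrightarrow> F i \<in> I_part C2"
    and "s \<in> S_part C1 \<Longrightarrow> F s \<in> S_part C2"
  using assms by (auto simp: IS_functor_def of_functor_def)

section \<open>Identities, composites and inverses of morphisms\<close>

lemma range_radiant_id:
  assumes "constellation_with_range P"
  shows "range_radiant P P (\<lambda>x\<in>carrier P. x)"
proof -
  interpret ranged_constellation P by unfold_locales (rule assms)
  show ?thesis
    unfolding range_radiant_def by (auto simp: mult_Some_iff)
qed

lemma range_radiant_compose: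
  assumes P: "constellation_with_range P"
    and f: "range_radiant P Q f" and g: "range_radiant Q T g"
  shows "range_radiant P T (compose (carrier P) g f)"
proof -
  interpret ranged_constellation P by unfold_locales (rule P)
  note f' = range_radiantD [OF f] and g' = range_radiantD [OF g]
  show ?thesis
    unfolding range_radiant_def
  proof (intro conjI ballI allI impI)
    show "compose (carrier P) g f \<in> carrier P \<rightarrow>\<^sub>E carrier T"
      using f'(2) g'(2) by (auto simp: compose_def)
  next
    fix s assume "s \<in> carrier P"
    thus "con_dom T (compose (carrier P) g f s) = compose (carrier P) g f (con_dom P s)"
      "con_ran T (compose (carrier P) g f s) = compose (carrier P) g f (con_ran P s)"
      by (simp_all add: compose_def f' g')
  next
    fix s t u assume st: "s \<in> carrier P" "t \<in> carrier P" and m: "mult P s t = Some u"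
    hence "u \<in> carrier P" by (auto simp: mult_Some_iff)
    moreover have "mult T (g (f s)) (g (f t)) = Some (g (f u))"
      by (rule g'(5)) (use st m f' in simp_all)
    ultimately show "mult T (compose (carrier P) g f s) (compose (carrier P) g f t) =
        Some (compose (carrier P) g f u)"
      using st by (simp add: compose_def)
  qed
qed

text \<open>A bijective radiant can create products, just as an order-preserving bijection of posets
  can create relations; \<open>refl\<close> excludes this.\<close>

lemma range_radiant_inverse:
  assumes P: "constellation_with_range P" and Q: "constellation_with_range Q"
    and f: "range_radiant P Q f" and bij: "bij_betw f (carrier P) (carrier Q)"
    and refl: "\<And>s t. \<lbrakk>s \<in> carrier P; t \<in> carrier P; mult Q (f s) (f t) \<noteq> None\<rbrakk> \<Longrightarrow> mult P s t \<noteq> None"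
  shows "range_radiant Q P (restrict (inv_into (carrier P) f) (carrier Q))"
proof -
  interpret P: ranged_constellation P by unfold_locales (rule P)
  interpret Q: ranged_constellation Q by unfold_locales (rule Q)
  note f' = range_radiantD [OF f]
  define g where "g = inv_into (carrier P) f"
  have gf: "g (f x) = x" if "x \<in> carrier P" for x
    using bij that unfolding g_def bij_betw_def by simp
  have ex: "\<exists>x\<in>carrier P. y = f x" if "y \<in> carrier Q" for y
    using bij that unfolding bij_betw_def by blast
  have "range_radiant Q P (restrict g (carrier Q))"
    unfolding range_radiant_def
  proof (intro conjI ballI allI impI)
    show "restrict g (carrier Q) \<in> carrier Q \<rightarrow>\<^sub>E carrier P"
      using gf ex by fastforce
  next
    fix y assume "y \<in> carrier Q"
    then obtain x where "x \<in> carrier P" "y = f x" using ex by blast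
    thus "con_dom P (restrict g (carrier Q) y) = restrict g (carrier Q) (con_dom Q y)"
      "con_ran P (restrict g (carrier Q) y) = restrict g (carrier Q) (con_ran Q y)"
      by (simp_all add: f' gf)
  next
    fix y z w assume "y \<in> carrier Q" "z \<in> carrier Q" and m: "mult Q y z = Some w"
    then obtain s t where st: "s \<in> carrier P" "y = f s" "t \<in> carrier P" "z = f t" using ex by meson
    then obtain u where u: "mult P s t = Some u" using refl m by blast
    hence "f u = w" "u \<in> carrier P" using f'(5) [OF st(1,3) u] m st by (auto simp: P.mult_Some_iff)
    thus "mult P (restrict g (carrier Q) y) (restrict g (carrier Q) z) = Some (restrict g (carrier Q) w)"
      using st u f' gf by auto
  qed
  thus ?thesis by (simp add: g_def)
qed

lemma IS_functor_id:
  assumes "IS_category C"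
  shows "IS_functor C C (\<lambda>x\<in>carrier C. x)"
proof -
  interpret is_category C by unfold_locales (rule assms)
  show ?thesis
    unfolding IS_functor_def of_functor_def by (auto simp: mult_Some_iff S_U I_U)
qed

lemma IS_functor_compose:
  assumes A: "IS_category A" and f: "IS_functor A B f" and g: "IS_functor B C g"
  shows "IS_functor A C (compose (carrier A) g f)"
proof -
  interpret is_category A by unfold_locales (rule A)
  note f' = IS_functorD [OF f] and g' = IS_functorD [OF g]
  have "of_functor A C (compose (carrier A) g f)"
    unfolding of_functor_def
  proof (intro conjI ballI allI impI)
    show "compose (carrier A) g f \<in> carrier A \<rightarrow>\<^sub>E carrier C"
      using f'(2) g'(2) by (auto simp: compose_def)
  next
    fix s assume "s \<in> carrier A"
    thus "cat_dom C (compose (carrier A) g f s) = compose (carrier A) g f (cat_dom A s)"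
      "cat_ran C (compose (carrier A) g f s) = compose (carrier A) g f (cat_ran A s)"
      by (simp_all add: compose_def f' g')
  next
    fix s t u assume st: "s \<in> carrier A" "t \<in> carrier A" and m: "mult A s t = Some u"
    hence "u \<in> carrier A" by (auto simp: mult_Some_iff)
    moreover have "mult C (g (f s)) (g (f t)) = Some (g (f u))"
      by (rule g'(5)) (use st m f' in simp_all)
    ultimately show "mult C (compose (carrier A) g f s) (compose (carrier A) g f t) =
        Some (compose (carrier A) g f u)"
      using st by (simp add: compose_def)
  qed
  thus ?thesis
    unfolding IS_functor_def using f'(6,7) g'(6,7) by (auto simp: compose_def S_U I_U)
qed

text \<open>Composability in a category is the equation \<open>R x = D y\<close>, which an injective
  functor reflects, so the inverse preserves composites. The two inclusions supply preservation of I
  and S.\<close>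

lemma IS_functor_inverse:
  assumes A: "IS_category A" and B: "IS_category B"
    and f: "IS_functor A B f" and bij: "bij_betw f (carrier A) (carrier B)"
    and I: "I_part B \<subseteq> f ` I_part A" and S: "S_part B \<subseteq> f ` S_part A"
  shows "IS_functor B A (restrict (inv_into (carrier A) f) (carrier B))"
proof -
  interpret A: is_category A by unfold_locales (rule A)
  interpret B: is_category B by unfold_locales (rule B)
  note f' = IS_functorD [OF f]
  define g where "g = inv_into (carrier A) f"
  have gf: "g (f x) = x" if "x \<in> carrier A" for x
    using bij that unfolding g_def bij_betw_def by simp
  have inj: "x = y" if "f x = f y" "x \<in> carrier A" "y \<in> carrier A" for x y
    using gf that by metis
  have ex: "\<exists>x\<in>carrier A. y = f x" if "y \<in> carrier B" for y
    using bij that unfolding bij_betw_def by blast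
  have "of_functor B A (restrict g (carrier B))"
    unfolding of_functor_def
  proof (intro conjI ballI allI impI)
    show "restrict g (carrier B) \<in> carrier B \<rightarrow>\<^sub>E carrier A"
      using gf ex by fastforce
  next
    fix y assume "y \<in> carrier B"
    then obtain x where "x \<in> carrier A" "y = f x" using ex by blast
    thus "cat_dom A (restrict g (carrier B) y) = restrict g (carrier B) (cat_dom B y)"
      "cat_ran A (restrict g (carrier B) y) = restrict g (carrier B) (cat_ran B y)"
      by (simp_all add: f' gf)
  next
    fix y z w assume "y \<in> carrier B" "z \<in> carrier B" and m: "mult B y z = Some w"
    then obtain s t where st: "s \<in> carrier A" "y = f s" "t \<in> carrier A" "z = f t" using ex by meson
    have "f (cat_ran A s) = f (cat_dom A t)"
      using m st f' by (simp add: B.mult_Some_iff)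
    hence "cat_ran A s = cat_dom A t" using inj st by simp
    then obtain u where u: "mult A s t = Some u" using st by (auto simp: A.mult_Some_iff)
    hence "f u = w" "u \<in> carrier A" using f'(5) [OF st(1,3) u] m st by (auto simp: A.mult_Some_iff)
    thus "mult A (restrict g (carrier B) y) (restrict g (carrier B) z) = Some (restrict g (carrier B) w)"
      using st u f' gf by auto
  qed
  moreover have "restrict g (carrier B) y \<in> I_part A" if "y \<in> I_part B" for y
    using that I B.I_U [OF that] A.I_U gf by force
  moreover have "restrict g (carrier B) y \<in> S_part A" if "y \<in> S_part B" for y
    using that S B.S_U [OF that] A.S_U gf by force
  ultimately show ?thesis
    unfolding IS_functor_def g_def by blast
qed

section \<open>The action of the two constructions on morphisms\<close>

lemma (in canonical) can_map_apply [simp]: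
  "pr (s, e) \<in> carrier E \<Longrightarrow> can_map pr Q \<rho> (pr (s, e)) = pr (\<rho> s, \<rho> e)"
  by (simp add: can_map_def)

text \<open>A radiant preserves existence of products, hence the order on identities; this keeps the
  condition \<open>R s \<le> e\<close> on pairs, and with it the part I.\<close>

lemma IS_functor_can_map:
  assumes inj: "inj pr" and P: "constellation_with_range P" and Q: "constellation_with_range Q"
    and \<rho>: "range_radiant P Q \<rho>"
  shows "IS_functor (canonical_extension pr P) (canonical_extension pr Q) (can_map pr P \<rho>)"
proof -
  interpret P: canonical P pr by unfold_locales (use inj P in simp_all)
  interpret Q: canonical Q pr by unfold_locales (use inj Q in simp_all)
  let ?F = "can_map pr P \<rho>"
  note r = range_radiantD [OF \<rho>]
  have D: "con_dom Q (\<rho> e) = \<rho> e" if "e \<in> P.U" "P.D e = e" for e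
    using r(3) [OF that(1)] that(2) by simp
  have le: "con_le Q (\<rho> e) (\<rho> f)" if "e \<in> P.U" "f \<in> P.U" "con_le P e f" for e f
    using that r(5) [of e f] unfolding con_le_def by blast
  have F: "?F x \<in> carrier Q.E" if x: "x \<in> carrier P.E" for x
  proof -
    obtain s e where "x = pr (s, e)" "s \<in> P.U" "e \<in> P.U" "P.D e = e" "con_le P (P.R s) e"
      using x by (rule P.carrierE)
    thus ?thesis using r D le [of "P.R s" e] by simp
  qed
  have "of_functor P.E Q.E ?F"
    unfolding of_functor_def
  proof (intro conjI ballI allI impI)
    show "?F \<in> carrier P.E \<rightarrow>\<^sub>E carrier Q.E"
      using F by (auto simp: can_map_def P.carrier_E PiE_iff)
  next
    fix x assume x: "x \<in> carrier P.E"
    then obtain s e where se: "x = pr (s, e)" "s \<in> P.U" "e \<in> P.U" "P.D e = e" "con_le P (P.R s) e"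
      by (rule P.carrierE)
    have "pr (\<rho> s, \<rho> e) \<in> carrier Q.E" using F [OF x] se x by simp
    thus "cat_dom Q.E (?F x) = ?F (cat_dom P.E x)" "cat_ran Q.E (?F x) = ?F (cat_ran P.E x)"
      using se by (simp_all add: P.R_proj r)
  next
    fix x y z assume x: "x \<in> carrier P.E" and y: "y \<in> carrier P.E" and m: "mult P.E x y = Some z"
    then obtain s e t f where se: "x = pr (s, e)" "s \<in> P.U" "e \<in> P.U" "y = pr (t, f)" "t \<in> P.U"
      by (metis P.carrierE)
    have z: "e = P.D t" "z = pr (composite P s t, f)"
      using m unfolding se(1,4) P.mult_E by (auto split: if_splits)
    have "z \<in> carrier P.E" using m P.E.comp_closed by (auto simp: P.E.mult_Some_iff)
    hence Fz: "?F z = pr (\<rho> (composite P s t), \<rho> f)" unfolding z by simp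
    have "mult P s t = Some (composite P s t)" using se z x by (simp add: P.mult_eq)
    hence "composite Q (\<rho> s) (\<rho> t) = \<rho> (composite P s t)"
      using r(5) [of s t] se by (simp add: composite_def)
    moreover have "?F x = pr (\<rho> s, \<rho> e)" "?F y = pr (\<rho> t, \<rho> f)" using se x y by simp_all
    moreover have "\<rho> e = con_dom Q (\<rho> t)" using z se r(3) by simp
    ultimately show "mult Q.E (?F x) (?F y) = Some (?F z)"
      using F [OF x] F [OF y] Fz by (simp add: Q.mult_E del: Q.carrier_iff)
  qed
  moreover have "?F i \<in> I_part Q.E" if i: "i \<in> I_part P.E" for i
  proof -
    obtain e f where "i = pr (e, f)" "e \<in> P.U" "f \<in> P.U" "P.D e = e" "P.D f = f" "con_le P e f"
      using i unfolding P.I_part_iff by blast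
    thus ?thesis unfolding Q.I_part_iff using r(2) D le by (auto simp: P.R_proj)
  qed
  moreover have "?F s \<in> S_part Q.E" if "s \<in> S_part P.E" for s
    using that r(2,4) unfolding Q.S_part_iff P.S_part_iff by force
  ultimately show ?thesis unfolding IS_functor_def by blast
qed

lemma (in is_category) con_dom_S [simp]: "s \<in> S \<Longrightarrow> con_dom (S_constellation C) s = D s"
  and con_ran_S [simp]: "s \<in> S \<Longrightarrow> con_ran (S_constellation C) s = R s"
  by (simp_all add: S.con_dom_eq S.con_ran_eq)

text \<open>The product of S'_A involves a restriction, so \<open>F\<close> has to commute with
  restriction. It does: \<open>F\<close> maps the square defining \<open>e|t\<close> to a square of
  the same kind in \<open>B\<close>, and such a square determines the restriction there.\<close>

lemma range_radiant_restrict_IS_functor: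
  assumes A: "IS_category A" and B: "IS_category B" and F: "IS_functor A B F"
  shows "range_radiant (S_constellation A) (S_constellation B) (restrict F (S_part A))"
proof -
  interpret A: is_category A by unfold_locales (rule A)
  interpret B: is_category B by unfold_locales (rule B)
  note F' = IS_functorD [OF F]
  have Fc: "composite B (F x) (F y) = F (composite A x y)"
    if "x \<in> A.U" "y \<in> A.U" "A.R x = A.D y" for x y
  proof -
    have "mult A x y = Some (composite A x y)" using that by (simp add: A.mult_eq)
    from F'(5) [OF that(1,2) this] show ?thesis by (simp add: composite_def)
  qed
  show ?thesis
    unfolding range_radiant_def
  proof (intro conjI ballI allI impI)
    show "restrict F A.S \<in> carrier (S_constellation A) \<rightarrow>\<^sub>E carrier (S_constellation B)"
      using F'(7) by auto
  next
    fix s assume "s \<in> carrier (S_constellation A)"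
    hence s: "s \<in> A.S" by simp
    thus "con_dom (S_constellation B) (restrict F A.S s) = restrict F A.S (con_dom (S_constellation A) s)"
      "con_ran (S_constellation B) (restrict F A.S s) = restrict F A.S (con_ran (S_constellation A) s)"
      using F' A.S_U A.S_proj by simp_all
  next
    fix s t u
    assume "s \<in> carrier (S_constellation A)" "t \<in> carrier (S_constellation A)"
      and "mult (S_constellation A) s t = Some u"
    hence st: "s \<in> A.S" "t \<in> A.S" "I_le A (A.R s) (A.D t)" and u: "u = composite A s (A.restr (A.R s) t)"
      by (auto simp: A.S.mult_Some_iff)
    have U: "s \<in> A.U" "t \<in> A.U" using st A.S_U by blast+
    obtain j where j: "j \<in> A.I" "A.D j = A.R s" "A.R j = A.D t"
      using st U A.I_le_D_iff [of "A.R s" "A.D t"] by auto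
    obtain i where i: "i \<in> A.I" "A.restr (A.R s) t \<in> A.S" "A.D (A.restr (A.R s) t) = A.R s"
      "A.R (A.restr (A.R s) t) = A.D i" "composite A (A.restr (A.R s) t) i = composite A j t"
      using A.I_restrict [OF st(2) j(1,3)] unfolding j(2) by blast
    note U' = U A.I_U [OF j(1)] A.I_U [OF i(1)] A.S_U [OF i(2)]
    have "B.restr (B.D (F j)) (F t) = F (A.restr (A.R s) t)"
    proof (rule B.I_restrict_eq)
      show "composite B (F (A.restr (A.R s) t)) (F i) = composite B (F j) (F t)"
        using U' i j by (simp add: Fc)
    qed (use F' U' i j st in simp_all)
    hence r: "B.restr (B.R (F s)) (F t) = F (A.restr (A.R s) t)" using F' U' j by simp
    have le: "I_le B (B.R (F s)) (B.D (F t))"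
      using B.I_le_domain_range [OF F'(6) [OF j(1)]] F' U' j by simp
    have "u \<in> A.S" unfolding u using A.S_comp [OF st(1) i(2)] i by simp
    thus "mult (S_constellation B) (restrict F A.S s) (restrict F A.S t) = Some (restrict F A.S u)"
      unfolding B.S.mult_Some_iff using st F'(7) r le U' i by (simp add: u Fc)
  qed
qed

section \<open>The unit and the counit\<close>

context canonical
begin

sublocale EI: is_category E
  by unfold_locales (rule IS_category_E)

lemma composite_E [simp]:
  "\<lbrakk>pr (s, e) \<in> carrier E; pr (t, f) \<in> carrier E; e = D t\<rbrakk> \<Longrightarrow>
    composite E (pr (s, e)) (pr (t, f)) = pr (s \<cdot> t, f)"
  by (simp add: composite_def [of E] mult_E del: carrier_iff)

text \<open>The only candidate for an element of I from \<open>(e, e)\<close> to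
  \<open>(f, f)\<close> is \<open>(e, f)\<close>, and it lies in I exactly when
  \<open>e \<le> f\<close>.\<close>

lemma I_le_E:
  assumes "e \<in> U" "f \<in> U" "D e = e" "D f = f"
  shows "I_le E (pr (e, e)) (pr (f, f)) \<longleftrightarrow> e \<preceq> f"
proof -
  have "I_le E (pr (e, e)) (pr (f, f)) \<longleftrightarrow>
      (\<exists>i\<in>I_part E. cat_dom E i = pr (e, e) \<and> cat_ran E i = pr (f, f))"
    using assms by (intro EI.I_le_D_iff) (simp_all add: R_proj)
  also have "\<dots> \<longleftrightarrow> e \<preceq> f"
  proof
    assume "\<exists>i\<in>I_part E. cat_dom E i = pr (e, e) \<and> cat_ran E i = pr (f, f)"
    then obtain i where i: "i \<in> I_part E" "cat_dom E i = pr (e, e)" "cat_ran E i = pr (f, f)" by blast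
    obtain a b where "i = pr (a, b)" "a \<in> U" "b \<in> U" "D a = a" "D b = b" "a \<preceq> b"
      using i(1) unfolding I_part_iff by blast
    thus "e \<preceq> f" using i(2,3) by (simp add: R_proj)
  next
    assume le: "e \<preceq> f"
    hence "pr (e, f) \<in> I_part E" using assms unfolding I_part_iff by blast
    thus "\<exists>i\<in>I_part E. cat_dom E i = pr (e, e) \<and> cat_ran E i = pr (f, f)"
      using assms le by (intro bexI [of _ "pr (e, f)"]) (simp_all add: R_proj)
  qed
  finally show ?thesis .
qed

text \<open>Both ways round the square give \<open>(e t, R t)\<close>. That its edge
  \<open>(R(e t), R t)\<close> lies in I is the inequality \<open>R(e t) \<le> R t\<close>.\<close>

lemma I_restrict_E:
  assumes t: "t \<in> U" and e: "e \<in> U" "D e = e" "e \<preceq> D t"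
  shows "I_restrict E (pr (e, e)) (pr (t, R t)) = pr (e \<cdot> t, R (e \<cdot> t))"
proof -
  have Re: "R e \<preceq> D t" using e R_proj by simp
  have et: "e \<cdot> t \<in> U" "D (e \<cdot> t) = e" "R (e \<cdot> t) \<preceq> R t"
    using comp_closed [OF e(1) t Re] D_comp [OF e(1) t Re] R_comp_le [OF e(1) t Re] e(2) by simp_all
  have "I_restrict E (cat_dom E (pr (e, D t))) (pr (t, R t)) = pr (e \<cdot> t, R (e \<cdot> t))"
  proof (rule EI.I_restrict_eq)
    show "pr (e \<cdot> t, R (e \<cdot> t)) \<in> S_part E" "pr (t, R t) \<in> S_part E"
      using et t by (auto simp: S_part_iff)
    show "pr (R (e \<cdot> t), R t) \<in> I_part E" "pr (e, D t) \<in> I_part E"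
      using et t e by (auto simp: I_part_iff)
    show "composite E (pr (e \<cdot> t, R (e \<cdot> t))) (pr (R (e \<cdot> t), R t)) = composite E (pr (e, D t)) (pr (t, R t))"
      using et t e Re by simp
  qed (use et t e Re in simp_all)
  thus ?thesis using t e Re by simp
qed

definition eta :: "'a \<Rightarrow> 'b" where
  "eta = (\<lambda>s\<in>U. pr (s, R s))"

text \<open>The constellation of C(Q) is a copy of \<open>Q\<close> in existence of products as well
  as in their values, so \<open>eta\<close> both preserves and reflects products. The value
  simplifies by \<open>s (R(s) t) = s t\<close> and the range axiom.\<close>

lemma mult_S_E:
  assumes s: "s \<in> U" and t: "t \<in> U"
  shows "mult (S_constellation E) (pr (s, R s)) (pr (t, R t)) =
    (if R s \<preceq> D t then Some (pr (s \<cdot> t, R (s \<cdot> t))) else None)"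
proof -
  have S: "pr (s, R s) \<in> S_part E" "pr (t, R t) \<in> S_part E" using s t by (auto simp: S_part_iff)
  have le: "I_le E (pr (R s, R s)) (pr (D t, D t)) \<longleftrightarrow> R s \<preceq> D t"
    using s t by (intro I_le_E) simp_all
  have "composite E (pr (s, R s)) (pr (R s \<cdot> t, R (R s \<cdot> t))) = pr (s \<cdot> t, R (s \<cdot> t))" if st: "R s \<preceq> D t"
  proof -
    have "s \<cdot> (R s \<cdot> t) = s \<cdot> t"
      using comp_assoc [of s "R s" t] s t st by simp
    thus ?thesis using s t st R_comp [OF s t st] by simp
  qed
  thus ?thesis
    using s t S le I_restrict_E [OF t, of "R s"] by (simp add: EI.S.mult_eq)
qed

lemma range_radiant_eta: "range_radiant Q (S_constellation E) eta"
  unfolding range_radiant_def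
proof (intro conjI ballI allI impI)
  show "eta \<in> U \<rightarrow>\<^sub>E carrier (S_constellation E)"
    by (auto simp: eta_def S_part_iff)
next
  fix s assume s: "s \<in> U"
  hence "pr (s, R s) \<in> S_part E" by (auto simp: S_part_iff)
  thus "con_dom (S_constellation E) (eta s) = eta (D s)" "con_ran (S_constellation E) (eta s) = eta (R s)"
    using s by (simp_all add: eta_def)
next
  fix s t u assume "s \<in> U" "t \<in> U" "mult Q s t = Some u"
  thus "mult (S_constellation E) (eta s) (eta t) = Some (eta u)"
    by (auto simp: mult_Some_iff eta_def mult_S_E)
qed

lemma bij_betw_eta: "bij_betw eta U (carrier (S_constellation E))"
  by (auto simp: bij_betw_def inj_on_def eta_def S_part_iff image_iff)

lemma mult_eta_reflect:
  "\<lbrakk>s \<in> U; t \<in> U; mult (S_constellation E) (eta s) (eta t) \<noteq> None\<rbrakk> \<Longrightarrow> mult Q s t \<noteq> None"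
  by (auto simp: eta_def mult_S_E mult_eq split: if_splits)

end

section \<open>The counit, from an IS-category to the extension of its constellation\<close>

locale is_category_pairing = is_category C
  for C :: "('a, 'b) IS_struct_scheme" +
  fixes pr :: "'a \<times> 'a \<Rightarrow> 'c"
  assumes inj_pr: "inj pr"
begin

sublocale T: canonical "S_constellation C" pr
  by unfold_locales (use constellation_with_range_S inj_pr in simp_all)

text \<open>The part in S of a factorisation as a function of \<open>x\<close>, needed to write
  \<open>tau\<close> on all of C. The part in I need not be recorded, as \<open>R s\<close> and
  \<open>R x\<close> determine it.\<close>

definition S_factor :: "'a \<Rightarrow> 'a" where
  "S_factor x = (THE s. s \<in> S \<and> (\<exists>i\<in>I. R s = D i \<and> s \<circ>\<circ> i = x))"

lemma S_factor_comp [simp]: "\<lbrakk>s \<in> S; i \<in> I; R s = D i\<rbrakk> \<Longrightarrow> S_factor (s \<circ>\<circ> i) = s"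
  unfolding S_factor_def by (rule the_equality) (auto dest: factor_unique(1))

lemma S_factor_S [simp]:
  assumes "s \<in> S"
  shows "S_factor s = s"
  using S_factor_comp [of s "R s"] assms S_U I_proj by simp

lemma S_factor_I [simp]:
  assumes "i \<in> I"
  shows "S_factor i = D i"
  using S_factor_comp [of "D i" i] assms I_U S_proj by simp

definition tau :: "'a \<Rightarrow> 'c" where
  "tau = (\<lambda>x\<in>U. pr (S_factor x, R x))"

text \<open>Links the order read off from the product of S'_C, in terms of which its extension is
  defined, with the arrows of I.\<close>

lemma con_le_S:
  assumes "e \<in> S" "f \<in> S" "D e = e" "D f = f"
  shows "con_le (S_constellation C) e f \<longleftrightarrow> I_le C e f"
  using S.con_le_iff [of e f] assms by (simp add: S.con_doms_iff)

lemma carrier_T_iff: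
  "pr (s, e) \<in> carrier T.E \<longleftrightarrow> s \<in> S \<and> e \<in> S \<and> D e = e \<and> I_le C (R s) e"
  using con_le_S [of "R s" e] S_U S_proj by auto

lemma tau_comp: "\<lbrakk>s \<in> S; i \<in> I; R s = D i\<rbrakk> \<Longrightarrow> tau (s \<circ>\<circ> i) = pr (s, R i)"
  by (simp add: tau_def S_U I_U)

lemma tau_closed:
  assumes "x \<in> U"
  shows "tau x \<in> carrier T.E"
proof -
  obtain s i where si: "s \<in> S" "i \<in> I" "R s = D i" "s \<circ>\<circ> i = x" using factor assms by blast
  hence "pr (s, R i) \<in> carrier T.E"
    unfolding carrier_T_iff using I_le_domain_range [of i] I_U S_proj by simp
  thus ?thesis using tau_comp si by metis
qed

lemma tau_S: "s \<in> S \<Longrightarrow> tau s = pr (s, R s)"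
  by (simp add: tau_def S_U)

lemma tau_I: "i \<in> I \<Longrightarrow> tau i = pr (D i, R i)"
  by (simp add: tau_def I_U)

text \<open>With \<open>x = s i\<close> and \<open>y = t j\<close>, the inner \<open>i t\<close> is
  exchanged for \<open>(D(i)|t) k\<close>. So \<open>x y\<close> factors as
  \<open>s (D(i)|t)\<close> followed by \<open>k j\<close>, and its part in S is the product of
  \<open>s\<close> and \<open>t\<close> in S'_C.\<close>

lemma tau_mult:
  assumes x: "x \<in> U" and y: "y \<in> U" and xy: "R x = D y"
  shows "mult T.E (tau x) (tau y) = Some (tau (x \<circ>\<circ> y))"
proof -
  obtain s i where si: "s \<in> S" "i \<in> I" "R s = D i" "s \<circ>\<circ> i = x" using factor x by blast
  obtain t j where tj: "t \<in> S" "j \<in> I" "R t = D j" "t \<circ>\<circ> j = y" using factor y by blast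
  note U = S_U [OF si(1)] I_U [OF si(2)] S_U [OF tj(1)] I_U [OF tj(2)]
  have it: "R i = D t" using R_comp [OF U(1,2)] D_comp [OF U(3,4)] si tj xy by simp
  obtain k where k: "k \<in> I" "restr (D i) t \<in> S" "D (restr (D i) t) = D i"
    "R (restr (D i) t) = D k" "R k = R t" "restr (D i) t \<circ>\<circ> k = i \<circ>\<circ> t"
    using I_restrict [OF tj(1) si(2) it] by blast
  note U' = U I_U [OF k(1)] S_U [OF k(2)]
  let ?t = "restr (D i) t"
  have "x \<circ>\<circ> y = s \<circ>\<circ> (i \<circ>\<circ> t \<circ>\<circ> j)"
    unfolding si(4) [symmetric] tj(4) [symmetric] using U' si(1-3) it tj(1-3) by (simp add: comp_assoc)
  also have "\<dots> = s \<circ>\<circ> (?t \<circ>\<circ> k \<circ>\<circ> j)" by (simp only: k(6))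
  also have "\<dots> = s \<circ>\<circ> ?t \<circ>\<circ> (k \<circ>\<circ> j)"
    using U' si it tj k(3-5) by (simp add: comp_assoc)
  finally have eq: "x \<circ>\<circ> y = s \<circ>\<circ> ?t \<circ>\<circ> (k \<circ>\<circ> j)" .
  have "tau (s \<circ>\<circ> ?t \<circ>\<circ> (k \<circ>\<circ> j)) = pr (s \<circ>\<circ> ?t, R (k \<circ>\<circ> j))"
    by (rule tau_comp) (use S_comp I_comp U' si tj k(1-5) in simp_all)
  hence 1: "tau (x \<circ>\<circ> y) = pr (s \<circ>\<circ> ?t, R j)" using eq U' tj k by simp
  have "I_le C (D i) (D t)" using I_le_domain_range [OF si(2)] it by simp
  hence "mult (S_constellation C) s t = Some (s \<circ>\<circ> ?t)"
    using si tj by (simp add: S.mult_eq)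
  hence 2: "composite (S_constellation C) s t = s \<circ>\<circ> ?t"
    by (simp add: composite_def [of "S_constellation C"])
  have tx: "tau x = pr (s, R i)" and ty: "tau y = pr (t, R j)"
    using tau_comp si tj by metis+
  have "pr (s, R i) \<in> carrier T.E" "pr (t, R j) \<in> carrier T.E"
    using tau_closed x y tx ty by metis+
  thus ?thesis
    using it tj unfolding 1 tx ty T.mult_E 2 by (simp del: T.carrier_iff)
qed

lemma IS_functor_tau: "IS_functor C T.E tau"
proof -
  have "of_functor C T.E tau"
    unfolding of_functor_def
  proof (intro conjI ballI allI impI)
    show "tau \<in> U \<rightarrow>\<^sub>E carrier T.E"
    proof (rule PiE_I)
      show "tau x = undefined" if "x \<notin> U" for x using that by (simp add: tau_def)
    qed (rule tau_closed)
  next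
    fix x assume x: "x \<in> U"
    then obtain s i where si: "s \<in> S" "i \<in> I" "R s = D i" "s \<circ>\<circ> i = x" using factor by blast
    note U = S_U [OF si(1)] I_U [OF si(2)]
    have tx: "tau x = pr (s, R i)" using tau_comp si by metis
    have c: "pr (s, R i) \<in> carrier T.E" using tau_closed x tx by metis
    have "D x = D s" "R x = R i" using D_comp [OF U] R_comp [OF U] si by simp_all
    moreover have "tau (D s) = pr (D s, D s)" "tau (R i) = pr (R i, R i)"
      using tau_I [of "D s"] tau_I [of "R i"] U I_proj by simp_all
    ultimately show "cat_dom T.E (tau x) = tau (D x)" "cat_ran T.E (tau x) = tau (R x)"
      unfolding tx T.cat_dom_E [OF c] T.cat_ran_E [OF c] using si by simp_all
  next
    fix x y z assume "x \<in> U" "y \<in> U" "mult C x y = Some z"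
    thus "mult T.E (tau x) (tau y) = Some (tau z)"
      using tau_mult by (auto simp: mult_Some_iff)
  qed
  moreover have "tau i \<in> I_part T.E" if i: "i \<in> I" for i
  proof -
    have "con_le (S_constellation C) (D i) (R i)"
      using con_le_S [of "D i" "R i"] I_le_domain_range [OF i] I_U [OF i] S_proj by simp
    thus ?thesis
      unfolding tau_I [OF i] T.I_part_iff using I_U [OF i] S_proj by auto
  qed
  moreover have "tau s \<in> S_part T.E" if "s \<in> S" for s
    unfolding tau_S [OF that] T.S_part_iff using that by auto
  ultimately show ?thesis unfolding IS_functor_def by blast
qed

lemma tau_surj_I: "I_part T.E \<subseteq> tau ` I"
proof
  fix x assume "x \<in> I_part T.E"
  then obtain e f where x: "x = pr (e, f)" and ef: "e \<in> S" "f \<in> S"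
      "con_dom (S_constellation C) e = e" "con_dom (S_constellation C) f = f" "con_le (S_constellation C) e f"
    unfolding T.I_part_iff by auto
  hence "D e = e" "D f = f" "I_le C e f" using con_le_S by auto
  then obtain i where i: "i \<in> I" "D i = e" "R i = f"
    using I_le_D_iff [of e f] ef S_U by auto
  hence "tau i = x" using tau_I x by simp
  thus "x \<in> tau ` I" using i by blast
qed

lemma tau_surj_S: "S_part T.E \<subseteq> tau ` S"
proof
  fix x assume "x \<in> S_part T.E"
  then obtain s where "s \<in> S" "x = pr (s, R s)" unfolding T.S_part_iff by auto
  thus "x \<in> tau ` S" using tau_S by (metis imageI)
qed

lemma bij_betw_tau: "bij_betw tau U (carrier T.E)"
  unfolding bij_betw_def
proof
  show "inj_on tau U"
  proof (rule inj_onI)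
    fix x y assume x: "x \<in> U" and y: "y \<in> U" and eq: "tau x = tau y"
    obtain s i where si: "s \<in> S" "i \<in> I" "R s = D i" "s \<circ>\<circ> i = x" using factor x by blast
    obtain t j where tj: "t \<in> S" "j \<in> I" "R t = D j" "t \<circ>\<circ> j = y" using factor y by blast
    have "tau x = pr (s, R i)" "tau y = pr (t, R j)" using tau_comp si tj by metis+
    hence "s = t" "R i = R j" using eq by simp_all
    moreover from this have "i = j" using I_unique [of i j] si tj by simp
    ultimately show "x = y" using si tj by simp
  qed
  show "tau ` U = carrier T.E"
  proof
    show "tau ` U \<subseteq> carrier T.E" using tau_closed by blast
    show "carrier T.E \<subseteq> tau ` U"
    proof
      fix z assume z: "z \<in> carrier T.E"
      then obtain s e where se: "z = pr (s, e)" by (metis T.carrierE)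
      hence c: "s \<in> S" "e \<in> S" "D e = e" "I_le C (R s) e" using z carrier_T_iff by metis+
      then obtain i where i: "i \<in> I" "D i = R s" "R i = e"
        using I_le_D_iff [of "R s" e] S_U by auto
      hence "tau (s \<circ>\<circ> i) = z" using tau_comp c se by simp
      moreover have "s \<circ>\<circ> i \<in> U" using c i S_U I_U by simp
      ultimately show "z \<in> tau ` U" by blast
    qed
  qed
qed

end

section \<open>Categories of structures and functions\<close>

text \<open>The identity laws are equalities of functions on the whole type, which is why morphisms
  must be extensional and composites are formed with \<open>compose\<close>.\<close>

lemma oa_category_concrete_cat:
  assumes ext: "\<And>P Q f. mor P Q f \<Longrightarrow> f \<in> U P \<rightarrow>\<^sub>E U Q"
    and id: "\<And>P. P \<in> Ob \<Longrightarrow> mor P P (\<lambda>x\<in>U P. x)"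
    and comp: "\<And>P Q T f g. \<lbrakk>P \<in> Ob; Q \<in> Ob; T \<in> Ob; mor P Q f; mor Q T g\<rbrakk> \<Longrightarrow>
      mor P T (compose (U P) g f)"
  shows "oa_category (concrete_cat Ob U mor)"
proof -
  have ext': "f \<in> U P \<rightarrow> U Q" "f \<in> extensional (U P)" if "mor P Q f" for P Q f
    using ext [OF that] by (simp_all add: PiE_def)
  have "compose (U P) (\<lambda>x\<in>U Q. x) f = f" "compose (U P) f (\<lambda>x\<in>U P. x) = f"
    and "compose (U P) h (compose (U P) g f) = compose (U P) (compose (U Q) h g) f"
    if "mor P Q f" for P Q f g h
    using ext' [OF that] by (simp_all add: Id_compose compose_Id compose_assoc)
  thus ?thesis
    unfolding oa_category_def concrete_cat_def by (auto simp: id comp)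
qed

lemma oa_iso_concrete_cat:
  assumes "P \<in> Ob" "Q \<in> Ob" "mor P Q f" "bij_betw f (U P) (U Q)"
    and "mor Q P (restrict (inv_into (U P) f) (U Q))"
  shows "oa_iso (concrete_cat Ob U mor) (P, f, Q)"
proof -
  let ?g = "restrict (inv_into (U P) f) (U Q)"
  have "compose (U P) ?g f = (\<lambda>x\<in>U P. x)" "compose (U Q) f ?g = (\<lambda>x\<in>U Q. x)"
    using assms(4) by (auto simp: compose_def fun_eq_iff bij_betw_def f_inv_into_f)
  thus ?thesis
    unfolding oa_iso_def concrete_cat_def using assms
    by (auto intro!: bexI [of _ "(Q, ?g, P)"])
qed

section \<open>The two categories and the functors between them\<close>

lemma oa_category_R_cat: "oa_category R_cat"
  unfolding R_cat_def
  by (rule oa_category_concrete_cat)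
    (erule range_radiantD(1), simp add: range_radiant_id, metis range_radiant_compose mem_Collect_eq)

lemma oa_category_IS_cat: "oa_category IS_cat"
  unfolding IS_cat_def
  by (rule oa_category_concrete_cat)
    (erule IS_functorD(1), simp add: IS_functor_id, metis IS_functor_compose mem_Collect_eq)

lemma R_cat_simps [simp]:
  "P \<in> Obj R_cat \<longleftrightarrow> constellation_with_range P"
  "(P, f, Q) \<in> Arr R_cat \<longleftrightarrow> constellation_with_range P \<and> constellation_with_range Q \<and> range_radiant P Q f"
  "Dom R_cat (P, f, Q) = P" "Cod R_cat (P, f, Q) = Q"
  "Id R_cat P = (P, (\<lambda>x\<in>carrier P. x), P)"
  "Comp R_cat (P, f, Q) (Q', g, T) = (P, compose (carrier P) g f, T)"
  by (simp_all add: R_cat_def concrete_cat_def)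

lemma IS_cat_simps [simp]:
  "C \<in> Obj IS_cat \<longleftrightarrow> IS_category C"
  "(C, f, C') \<in> Arr IS_cat \<longleftrightarrow> IS_category C \<and> IS_category C' \<and> IS_functor C C' f"
  "Dom IS_cat (C, f, C') = C" "Cod IS_cat (C, f, C') = C'"
  "Id IS_cat C = (C, (\<lambda>x\<in>carrier C. x), C)"
  "Comp IS_cat (C, f, C') (C'', g, C''') = (C, compose (carrier C) g f, C''')"
  by (simp_all add: IS_cat_def concrete_cat_def)

lemma oa_functor_id:
  assumes "oa_category K"
  shows "oa_functor K K id_functor"
  using assms unfolding oa_functor_def oa_category_def id_functor_def by simp

lemma oa_functor_comp:
  assumes "oa_functor K L F" "oa_functor L M G"
  shows "oa_functor K M (F ;; G)"
proof -
  have "oa_category K" using assms(1) by (simp add: oa_functor_def)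
  hence "Dom K f \<in> Obj K" "Cod K f \<in> Obj K" if "f \<in> Arr K" for f
    using that by (simp_all add: oa_category_def)
  thus ?thesis
    using assms unfolding oa_functor_def comp_functor_def by simp
qed

lemma oa_functor_phi:
  fixes pr :: "'u \<times> 'u \<Rightarrow> 'u"
  assumes "inj pr"
  shows "oa_functor R_cat IS_cat (phi pr)"
proof -
  have IS: "IS_category (canonical_extension pr P)" if "constellation_with_range P" for P :: "'u pstruct"
  proof -
    interpret canonical P pr by unfold_locales (use that assms in simp_all)
    show ?thesis by (rule IS_category_E)
  qed
  have id: "can_map pr P (\<lambda>x\<in>carrier P. x) = (\<lambda>x\<in>carrier (canonical_extension pr P). x)"
    if "constellation_with_range P" for P :: "'u pstruct"
  proof -
    interpret canonical P pr by unfold_locales (use that assms in simp_all)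
    have "can_map pr P (\<lambda>x\<in>carrier P. x) x = x" if "x \<in> carrier E" for x
      using that by (elim carrierE) simp
    moreover have "can_map pr P (\<lambda>x\<in>carrier P. x) x = undefined" if "x \<notin> carrier E" for x
      using that by (simp add: can_map_def carrier_E)
    ultimately show ?thesis by (auto simp: fun_eq_iff)
  qed
  have comp: "can_map pr P (compose (carrier P) g f) =
      compose (carrier (canonical_extension pr P)) (can_map pr Q g) (can_map pr P f)"
    if P: "constellation_with_range P" and Q: "constellation_with_range Q" and f: "range_radiant P Q f"
    for P Q :: "'u pstruct" and f g
  proof
    interpret P: canonical P pr by unfold_locales (use P assms in simp_all)
    interpret Q: canonical Q pr by unfold_locales (use Q assms in simp_all)
    fix x
    show "can_map pr P (compose (carrier P) g f) x = compose (carrier P.E) (can_map pr Q g) (can_map pr P f) x"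
    proof (cases "x \<in> carrier P.E")
      case True
      then obtain s e where se: "x = pr (s, e)" "s \<in> P.U" "e \<in> P.U" by (metis P.carrierE)
      have "can_map pr P f x \<in> carrier Q.E"
        using IS_functorD(2) [OF IS_functor_can_map [OF assms P Q f]] True by blast
      hence "pr (f s, f e) \<in> carrier Q.E" using se True by (simp del: P.carrier_iff Q.carrier_iff)
      thus ?thesis
        using True se by (simp add: compose_def del: P.carrier_iff Q.carrier_iff)
    next
      case False
      thus ?thesis by (simp add: can_map_def P.carrier_E compose_def)
    qed
  qed
  show ?thesis
    unfolding oa_functor_def
  proof (intro conjI ballI impI oa_category_R_cat oa_category_IS_cat)
    fix f g :: "('u pstruct, 'u) arrow"
    assume "f \<in> Arr R_cat" "g \<in> Arr R_cat" "Cod R_cat f = Dom R_cat g"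
    moreover obtain P f' Q Q' g' T where "f = (P, f', Q)" "g = (Q', g', T)" by (metis prod.exhaust)
    ultimately show "on_arr (phi pr) (Comp R_cat f g) = Comp IS_cat (on_arr (phi pr) f) (on_arr (phi pr) g)"
      by (simp add: phi_def comp)
  qed (auto simp: phi_def IS id IS_functor_can_map assms)
qed

lemma oa_functor_psi: "oa_functor IS_cat R_cat psi"
proof -
  have cwr: "constellation_with_range (S_constellation C)" if "IS_category C" for C :: "'a IS_struct"
  proof -
    interpret is_category C by unfold_locales (rule that)
    show ?thesis by (rule constellation_with_range_S)
  qed
  have SU: "S_part C \<subseteq> carrier C" if "IS_category C" for C :: "'a IS_struct"
  proof -
    interpret is_category C by unfold_locales (rule that)
    show ?thesis using S_U by blast
  qed
  have comp: "restrict (compose (carrier A) g f) (S_part A) =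
      compose (S_part A) (restrict g (S_part B)) (restrict f (S_part A))"
    if "IS_category A" "IS_functor A B f" for A B :: "'a IS_struct" and f g
    using SU [OF that(1)] IS_functorD(7) [OF that(2)] by (auto simp: fun_eq_iff compose_def)
  have carr: "carrier (S_constellation C) = S_part C" for C :: "'a IS_struct"
    by (simp add: S_constellation_def)
  show ?thesis
    unfolding oa_functor_def
  proof (intro conjI ballI impI oa_category_R_cat oa_category_IS_cat)
    fix f g :: "('a IS_struct, 'a) arrow"
    assume "f \<in> Arr IS_cat" "g \<in> Arr IS_cat" "Cod IS_cat f = Dom IS_cat g"
    moreover obtain A f' B B' g' C where "f = (A, f', B)" "g = (B', g', C)" by (metis prod.exhaust)
    ultimately show "on_arr psi (Comp IS_cat f g) = Comp R_cat (on_arr psi f) (on_arr psi g)"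
      by (simp add: psi_def comp carr)
  qed (use SU in \<open>auto simp: psi_def cwr carr range_radiant_restrict_IS_functor fun_eq_iff\<close>)
qed

section \<open>The natural isomorphisms and the equivalence\<close>

definition unit_arrow :: "('u \<times> 'u \<Rightarrow> 'u) \<Rightarrow> 'u pstruct \<Rightarrow> ('u pstruct, 'u) arrow" where
  "unit_arrow pr P = (P, canonical.eta P pr, S_constellation (canonical_extension pr P))"

definition counit_arrow :: "('u \<times> 'u \<Rightarrow> 'u) \<Rightarrow> 'u IS_struct \<Rightarrow> ('u IS_struct, 'u) arrow" where
  "counit_arrow pr C = (C, is_category_pairing.tau C pr, canonical_extension pr (S_constellation C))"

lemma natural_iso_unit:
  fixes pr :: "'u \<times> 'u \<Rightarrow> 'u"
  assumes "inj pr"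
  shows "natural_iso R_cat R_cat id_functor (phi pr ;; psi) (unit_arrow pr)"
  unfolding natural_iso_def
proof (intro conjI ballI)
  show "oa_functor R_cat R_cat id_functor" by (rule oa_functor_id [OF oa_category_R_cat])
  show "oa_functor R_cat R_cat (phi pr ;; psi)"
    by (rule oa_functor_comp [OF oa_functor_phi [OF assms] oa_functor_psi])
next
  fix P :: "'u pstruct"
  assume "P \<in> Obj R_cat"
  hence P: "constellation_with_range P" by simp
  interpret canonical P pr by unfold_locales (use P assms in simp_all)
  have "range_radiant (S_constellation E) P (restrict (inv_into U eta) (carrier (S_constellation E)))"
    by (rule range_radiant_inverse [OF P EI.constellation_with_range_S range_radiant_eta bij_betw_eta
          mult_eta_reflect])
  thus "oa_iso R_cat (unit_arrow pr P)"
    unfolding R_cat_def unit_arrow_def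
    by (intro oa_iso_concrete_cat)
      (use P EI.constellation_with_range_S range_radiant_eta bij_betw_eta in simp_all)
  show "Dom R_cat (unit_arrow pr P) = on_obj id_functor P"
    "Cod R_cat (unit_arrow pr P) = on_obj (phi pr ;; psi) P"
    by (simp_all add: unit_arrow_def id_functor_def comp_functor_def phi_def psi_def)
next
  fix \<rho> :: "('u pstruct, 'u) arrow"
  assume "\<rho> \<in> Arr R_cat"
  then obtain P f Q where \<rho>: "\<rho> = (P, f, Q)"
    and P: "constellation_with_range P" and Q: "constellation_with_range Q" and f: "range_radiant P Q f"
    by (cases \<rho>) auto
  interpret P: canonical P pr by unfold_locales (use P assms in simp_all)
  interpret Q: canonical Q pr by unfold_locales (use Q assms in simp_all)
  \<comment> \<open>Both sides send \<open>s\<close> to a pair with first entry \<open>f s\<close>;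
    the second entries are \<open>R(f s)\<close> and \<open>f(R s)\<close>, so naturality amounts to
    preservation of \<open>R\<close>.\<close>
  have "compose P.U Q.eta f = compose P.U (restrict (can_map pr P f) (S_part P.E)) P.eta"
  proof
    fix s
    show "compose P.U Q.eta f s = compose P.U (restrict (can_map pr P f) (S_part P.E)) P.eta s"
    proof (cases "s \<in> P.U")
      case True
      hence "pr (s, P.R s) \<in> S_part P.E" by (auto simp: P.S_part_iff)
      thus ?thesis
        using True range_radiantD(2,4) [OF f] by (simp add: compose_def P.eta_def Q.eta_def)
    qed (simp add: compose_def)
  qed
  thus "Comp R_cat (on_arr id_functor \<rho>) (unit_arrow pr (Cod R_cat \<rho>)) =
      Comp R_cat (unit_arrow pr (Dom R_cat \<rho>)) (on_arr (phi pr ;; psi) \<rho>)"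
    by (simp add: \<rho> unit_arrow_def id_functor_def comp_functor_def phi_def psi_def)
qed

lemma natural_iso_counit:
  fixes pr :: "'u \<times> 'u \<Rightarrow> 'u"
  assumes "inj pr"
  shows "natural_iso IS_cat IS_cat id_functor (psi ;; phi pr) (counit_arrow pr)"
  unfolding natural_iso_def
proof (intro conjI ballI)
  show "oa_functor IS_cat IS_cat id_functor" by (rule oa_functor_id [OF oa_category_IS_cat])
  show "oa_functor IS_cat IS_cat (psi ;; phi pr)"
    by (rule oa_functor_comp [OF oa_functor_psi oa_functor_phi [OF assms]])
next
  fix C :: "'u IS_struct"
  assume "C \<in> Obj IS_cat"
  hence C: "IS_category C" by simp
  interpret is_category_pairing C pr by unfold_locales (use C assms in simp_all)
  have "IS_functor T.E C (restrict (inv_into U tau) (carrier T.E))"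
    by (rule IS_functor_inverse [OF C T.IS_category_E IS_functor_tau bij_betw_tau tau_surj_I tau_surj_S])
  thus "oa_iso IS_cat (counit_arrow pr C)"
    unfolding IS_cat_def counit_arrow_def
    by (intro oa_iso_concrete_cat)
      (use C T.IS_category_E IS_functor_tau bij_betw_tau in simp_all)
  show "Dom IS_cat (counit_arrow pr C) = on_obj id_functor C"
    "Cod IS_cat (counit_arrow pr C) = on_obj (psi ;; phi pr) C"
    by (simp_all add: counit_arrow_def id_functor_def comp_functor_def phi_def psi_def)
next
  fix F :: "('u IS_struct, 'u) arrow"
  assume "F \<in> Arr IS_cat"
  then obtain A f B where F: "F = (A, f, B)"
    and A: "IS_category A" and B: "IS_category B" and f: "IS_functor A B f"
    by (cases F) auto
  interpret A: is_category_pairing A pr by unfold_locales (use A assms in simp_all)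
  interpret B: is_category_pairing B pr by unfold_locales (use B assms in simp_all)
  note f' = IS_functorD [OF f]
  let ?F = "can_map pr (S_constellation A) (restrict f A.S)"
  \<comment> \<open>An IS-functor carries the factorisation \<open>x = s i\<close> to the
    factorisation of \<open>f x\<close>, so both sides are the pair of \<open>f s\<close> and
    \<open>f(R i)\<close>.\<close>
  have "compose A.U B.tau f = compose A.U ?F A.tau"
  proof
    fix x
    show "compose A.U B.tau f x = compose A.U ?F A.tau x"
    proof (cases "x \<in> A.U")
      case True
      then obtain s i where si: "s \<in> A.S" "i \<in> A.I" "A.R s = A.D i" "composite A s i = x"
        using A.factor by blast
      note U = A.S_U [OF si(1)] A.I_U [OF si(2)]
      have tx: "A.tau x = pr (s, A.R i)" using A.tau_comp si by metis
      have "mult A s i = Some x" using si U by (simp add: A.mult_Some_iff)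
      hence "composite B (f s) (f i) = f x" using f'(5) [of s i x] U by (simp add: composite_def [of B])
      moreover have "B.tau (composite B (f s) (f i)) = pr (f s, B.R (f i))"
        by (rule B.tau_comp) (use f' si U in simp_all)
      ultimately have 1: "B.tau (f x) = pr (f s, f (A.R i))" using f' U by simp
      have "pr (s, A.R i) \<in> carrier A.T.E" using A.tau_closed True tx by metis
      hence "?F (pr (s, A.R i)) = pr (restrict f A.S s, restrict f A.S (A.R i))"
        by (rule A.T.can_map_apply)
      thus ?thesis using True tx 1 si U A.S_proj by (simp add: compose_def)
    qed (simp add: compose_def)
  qed
  thus "Comp IS_cat (on_arr id_functor F) (counit_arrow pr (Cod IS_cat F)) =
      Comp IS_cat (counit_arrow pr (Dom IS_cat F)) (on_arr (psi ;; phi pr) F)"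
    by (simp add: F counit_arrow_def id_functor_def comp_functor_def phi_def psi_def)
qed

theorem theorem9p5:
  fixes pr :: "'u \<times> 'u \<Rightarrow> 'u"
  assumes "inj pr"
  shows
    "(oa_functor R_cat IS_cat (phi pr) \<and>
      (\<forall>Q :: 'u pstruct. constellation_with_range Q \<and> left_cancellative Q \<longrightarrow>
         regular (canonical_extension pr Q))) \<and>
     (oa_functor IS_cat R_cat (psi :: ('u IS_struct, _, _, _) oa_map) \<and>
      (\<forall>C :: 'u IS_struct. IS_category C \<and> regular C \<longrightarrow>
         left_cancellative (S_constellation C))) \<and>
     (\<exists>\<eta> \<tau>.
        natural_iso R_cat R_cat id_functor (phi pr ;; psi) \<eta> \<and>
        natural_iso IS_cat IS_cat id_functor (psi ;; phi pr) \<tau> \<and>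
        (\<forall>P :: 'u pstruct. constellation_with_range P \<longrightarrow>
           (\<forall>s\<in>carrier P. arrow_fun (\<eta> P) s = pr (s, con_ran P s))) \<and>
        (\<forall>C :: 'u IS_struct. IS_category C \<longrightarrow>
           (\<forall>x\<in>carrier C. \<forall>s\<in>S_part C. \<forall>i\<in>I_part C. mult C s i = Some x \<longrightarrow>
              arrow_fun (\<tau> C) x = pr (s, cat_ran C x)))) \<and>
     equivalent_categories R_cat IS_cat (phi pr) psi"
proof (intro conjI allI impI)
  show phi: "oa_functor R_cat IS_cat (phi pr)" by (rule oa_functor_phi [OF assms])
  show psi: "oa_functor IS_cat R_cat (psi :: ('u IS_struct, _, _, _) oa_map)" by (rule oa_functor_psi)
  show "equivalent_categories R_cat IS_cat (phi pr) psi"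
    unfolding equivalent_categories_def
    using phi psi natural_iso_unit [OF assms] natural_iso_counit [OF assms] by blast
next
  fix Q :: "'u pstruct"
  assume Q: "constellation_with_range Q \<and> left_cancellative Q"
  interpret canonical Q pr by unfold_locales (use Q assms in simp_all)
  show "regular (canonical_extension pr Q)" using Q by (intro regular_E) simp
next
  fix C :: "'u IS_struct"
  assume C: "IS_category C \<and> regular C"
  interpret is_category C by unfold_locales (use C in simp)
  show "left_cancellative (S_constellation C)" using C by (intro left_cancellative_S) simp
next
  have "arrow_fun (unit_arrow pr P) s = pr (s, con_ran P s)"
    if P: "constellation_with_range P" and s: "s \<in> carrier P" for P :: "'u pstruct" and s
  proof -
    interpret canonical P pr by unfold_locales (use P assms in simp_all)
    show ?thesis using s by (simp add: arrow_fun_def unit_arrow_def eta_def)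
  qed
  moreover have "arrow_fun (counit_arrow pr C) x = pr (s, cat_ran C x)"
    if C: "IS_category C" and x: "s \<in> S_part C" "i \<in> I_part C" "mult C s i = Some x" for C :: "'u IS_struct" and x s i
  proof -
    interpret is_category_pairing C pr by unfold_locales (use C assms in simp_all)
    \<comment> \<open>The formula is claimed for every factorisation of \<open>x\<close>; as there
      is just one, \<open>tau_comp\<close> computes the value from the given one.\<close>
    have "R s = D i" "x = composite C s i" using x by (auto simp: mult_Some_iff)
    thus ?thesis using x S_U I_U by (simp add: arrow_fun_def counit_arrow_def tau_comp)
  qed
  ultimately show "\<exists>\<eta> \<tau>.
        natural_iso R_cat R_cat id_functor (phi pr ;; psi) \<eta> \<and>
        natural_iso IS_cat IS_cat id_functor (psi ;; phi pr) \<tau> \<and>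
        (\<forall>P :: 'u pstruct. constellation_with_range P \<longrightarrow>
           (\<forall>s\<in>carrier P. arrow_fun (\<eta> P) s = pr (s, con_ran P s))) \<and>
        (\<forall>C :: 'u IS_struct. IS_category C \<longrightarrow>
           (\<forall>x\<in>carrier C. \<forall>s\<in>S_part C. \<forall>i\<in>I_part C. mult C s i = Some x \<longrightarrow>
              arrow_fun (\<tau> C) x = pr (s, cat_ran C x)))"
    using natural_iso_unit [OF assms] natural_iso_counit [OF assms]
    by (intro exI [of _ "unit_arrow pr"] exI [of _ "counit_arrow pr"]) blast
qed

end
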